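(* The norm of the space $M$ is octahedral. Moreover, $M$ has the strong diameter two property, and so the norm of $M^*$ is octahedral.
   Context: All Banach spaces are real. For a Banach space $X$, $B_X$ and $S_X$ are its closed unit ball and unit sphere and $X^*$ its topological dual; for bounded $A\subseteq X$, $x^*\in X^*$ and $\alpha>0$, the slice is $S(A,x^*,\alpha)=\{x\in A:x^*(x)>\sup_{y\in A}x^*(y)-\alpha\}$. $X$ has the strong diameter two property if every convex combination of slices of $B_X$, i.e. every set $\sum_{i=1}^n\lambda_iS_i$ with $S_i$ slices of $B_X$, $\lambda_i\ge0$, $\sum_i\lambda_i=1$, has diameter $2$. The norm of $X$ is octahedral if for every $\varepsilon>0$ and every finite-dimensional subspace $Y$ of $X$ there is $x\in S_X$ such that $\|\lambda x+y\|\ge(1-\varepsilon)(|\lambda|+\|y\|)$ for every $y\in Y$ and every scalar $\lambda$. The tree: $T=\{\emptyset\}\cup\{(\alpha_1,\ldots,\alpha_k): k\in\mathbb N,\ \alpha_1,\ldots,\alpha_k\in\mathbb N\}$ is the set of finite sequences of natural numbers, partially ordered by initial-segment extension, with $\emptyset$ the least element; $|(\alpha_1,\ldots,\alpha_k)|=k$ and $|\emptyset|=0$. A segment is a non-empty finite interval of $T$, i.e. a set $\{t\in T:s\le t\le s'\}$ with $s\le s'$; it is an $n$-$m$ segment if $|s|=n$ and $|s'|=m$. A finite family $\{S_1,\ldots,S_k\}$ of segments is admissible if there are $n\le m$ such that every $S_i$ is an $n$-$m$ segment and $S_i\cap S_j=\emptyset$ for $i\ne j$. On finitely nonzero functions $x:T\to\mathbb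 R$ consider the norm $\|x\|=\sup\sum_{i=1}^k\left|\sum_{t\in S_i}x(t)\right|$, the supremum being over all admissible families $\{S_1,\ldots,S_k\}$ of segments of $T$; $JH_\infty$ is the completion of the space of all finitely nonzero functions under this norm. Let $N$ be the space of finitely nonzero $x:T\to\mathbb R$ with $x(\emptyset)=0$. $M$ is the completion of $N$ under this norm, viewed as a closed subspace (a hyperplane) of $JH_\infty$. *)

theory Defs
  imports "HOL-Analysis.Analysis" "HOL-Library.Sublist"
begin

section \<open>Octahedral norms and the strong diameter two property\<close>

definition octahedral_norm :: "'a::real_normed_vector itself \<Rightarrow> bool" where
  "octahedral_norm _ \<longleftrightarrow>
    (\<forall>\<epsilon>>0. \<forall>Y::'a set. subspace Y \<and> (\<exists>B. finite B \<and> span B = Y) \<longrightarrow>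
      (\<exists>x. norm x = 1 \<and>
        (\<forall>y\<in>Y. \<forall>l::real. norm (l *\<^sub>R x + y) \<ge> (1 - \<epsilon>) * (\<bar>l\<bar> + norm y))))"

text \<open>The supremum is the intended one for non-empty bounded \<open>A\<close>, the only case used.\<close>

definition slice :: "'a::real_normed_vector set \<Rightarrow> ('a \<Rightarrow>\<^sub>L real) \<Rightarrow> real \<Rightarrow> 'a set" where
  "slice A f \<alpha> = {x \<in> A. blinfun_apply f x > (SUP y\<in>A. blinfun_apply f y) - \<alpha>}"

definition is_slice_of :: "'a::real_normed_vector set \<Rightarrow> 'a set \<Rightarrow> bool" where
  "is_slice_of S A \<longleftrightarrow> (\<exists>f \<alpha>. \<alpha> > 0 \<and> S = slice A f \<alpha>)"

definition strong_diameter_two :: "'a::real_normed_vector itself \<Rightarrow> bool" where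
  "strong_diameter_two _ \<longleftrightarrow>
    (\<forall>(n::nat) (S :: nat \<Rightarrow> 'a set) (l :: nat \<Rightarrow> real).
      (\<forall>i<n. is_slice_of (S i) (cball 0 1)) \<and> (\<forall>i<n. l i \<ge> 0) \<and> (\<Sum>i<n. l i) = 1 \<longrightarrow>
      diameter {(\<Sum>i<n. l i *\<^sub>R s i) | s. \<forall>i<n. s i \<in> S i} = 2)"


section \<open>The completion of a normed space\<close>

text \<open>Cauchy sequences modulo null sequences.\<close>

definition cauchy_rel :: "(nat \<Rightarrow> 'a::real_normed_vector) \<Rightarrow> (nat \<Rightarrow> 'a) \<Rightarrow> bool" where
  "cauchy_rel X Y \<longleftrightarrow> Cauchy X \<and> Cauchy Y \<and> (\<lambda>n. X n - Y n) \<longlonglongrightarrow> 0"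

lemma cauchy_rel_part_equivp: "part_equivp cauchy_rel"
proof (rule part_equivpI)
  show "\<exists>x::nat \<Rightarrow> 'a. cauchy_rel x x"
    by (rule exI[of _ "\<lambda>_. 0"]) (simp add: cauchy_rel_def convergent_Cauchy convergent_const)
  show "symp (cauchy_rel :: (nat \<Rightarrow> 'a) \<Rightarrow> _)"
  proof (rule sympI)
    fix X Y :: "nat \<Rightarrow> 'a" assume a: "cauchy_rel X Y"
    then have "(\<lambda>n. - (X n - Y n)) \<longlonglongrightarrow> - 0"
      unfolding cauchy_rel_def by (intro tendsto_minus) auto
    then show "cauchy_rel Y X" using a by (simp add: cauchy_rel_def)
  qed
  show "transp (cauchy_rel :: (nat \<Rightarrow> 'a) \<Rightarrow> _)"
  proof (rule transpI)
    fix X Y Z :: "nat \<Rightarrow> 'a" assume a: "cauchy_rel X Y" "cauchy_rel Y Z"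
    then have "(\<lambda>n. (X n - Y n) + (Y n - Z n)) \<longlonglongrightarrow> 0 + 0"
      unfolding cauchy_rel_def by (intro tendsto_add) auto
    then show "cauchy_rel X Z" using a by (simp add: cauchy_rel_def)
  qed
qed

quotient_type (overloaded) 'a completion =
  "nat \<Rightarrow> 'a::real_normed_vector" / partial: cauchy_rel
  by (rule cauchy_rel_part_equivp)

lemma Cauchy_add: "Cauchy X \<Longrightarrow> Cauchy Y \<Longrightarrow> Cauchy (\<lambda>n. X n + Y n)"
  for X Y :: "nat \<Rightarrow> 'a::real_normed_vector"
proof (rule metric_CauchyI)
  fix e :: real assume X: "Cauchy X" and Y: "Cauchy Y" and e: "0 < e"
  from metric_CauchyD[OF X, of "e/2"] e obtain M
    where M: "\<And>m n. m \<ge> M \<Longrightarrow> n \<ge> M \<Longrightarrow> dist (X m) (X n) < e/2" by auto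
  from metric_CauchyD[OF Y, of "e/2"] e obtain N
    where N: "\<And>m n. m \<ge> N \<Longrightarrow> n \<ge> N \<Longrightarrow> dist (Y m) (Y n) < e/2" by auto
  show "\<exists>K. \<forall>m\<ge>K. \<forall>n\<ge>K. dist (X m + Y m) (X n + Y n) < e"
  proof (intro exI[of _ "max M N"] allI impI)
    fix m n assume "m \<ge> max M N" "n \<ge> max M N"
    then have "dist (X m) (X n) < e/2" "dist (Y m) (Y n) < e/2" using M N by auto
    then show "dist (X m + Y m) (X n + Y n) < e"
      using dist_triangle_add[of "X m" "Y m" "X n" "Y n"] by linarith
  qed
qed

lemma Cauchy_scaleR: "Cauchy X \<Longrightarrow> Cauchy (\<lambda>n. r *\<^sub>R X n)"
  for X :: "nat \<Rightarrow> 'a::real_normed_vector"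
  by (rule bounded_linear.Cauchy[OF bounded_linear_scaleR_right])

lemma Cauchy_uminus: "Cauchy X \<Longrightarrow> Cauchy (\<lambda>n. - X n)"
  for X :: "nat \<Rightarrow> 'a::real_normed_vector"
  using Cauchy_scaleR[of X "-1"] by simp

lemma Cauchy_const: "Cauchy (\<lambda>_. c)"
  by (intro convergent_Cauchy convergent_const)

lemma Cauchy_norm_tendsto:
  fixes X :: "nat \<Rightarrow> 'a::real_normed_vector"
  assumes "Cauchy X"
  shows "(\<lambda>n. norm (X n)) \<longlonglongrightarrow> lim (\<lambda>n. norm (X n))"
proof -
  have "Cauchy (\<lambda>n. norm (X n))"
  proof (rule metric_CauchyI)
    fix e :: real assume "0 < e"
    from metric_CauchyD[OF assms this] show "\<exists>K. \<forall>m\<ge>K. \<forall>n\<ge>K. dist (norm (X m)) (norm (X n)) < e"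
      by (metis dist_norm dist_real_def norm_triangle_ineq3 order_le_less_trans)
  qed
  then show ?thesis by (simp add: Cauchy_convergent_iff convergent_LIMSEQ_iff)
qed

instantiation completion :: (real_normed_vector) real_normed_vector
begin

lift_definition zero_completion :: "'a completion" is "\<lambda>_. 0"
  by (simp add: cauchy_rel_def Cauchy_const)

lift_definition plus_completion :: "'a completion \<Rightarrow> 'a completion \<Rightarrow> 'a completion"
  is "\<lambda>X Y n. X n + Y n"
  unfolding cauchy_rel_def
proof (elim conjE, intro conjI Cauchy_add)
  fix X X' Y Y' :: "nat \<Rightarrow> 'a"
  assume "(\<lambda>n. X n - X' n) \<longlonglongrightarrow> 0" "(\<lambda>n. Y n - Y' n) \<longlonglongrightarrow> 0"
  then have "(\<lambda>n. (X n - X' n) + (Y n - Y' n)) \<longlonglongrightarrow> 0 + 0" by (rule tendsto_add)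
  then show "(\<lambda>n. X n + Y n - (X' n + Y' n)) \<longlonglongrightarrow> 0" by (simp add: algebra_simps)
qed

lift_definition uminus_completion :: "'a completion \<Rightarrow> 'a completion" is "\<lambda>X n. - X n"
  unfolding cauchy_rel_def
proof (elim conjE, intro conjI Cauchy_uminus)
  fix X X' :: "nat \<Rightarrow> 'a"
  assume "(\<lambda>n. X n - X' n) \<longlonglongrightarrow> 0"
  then have "(\<lambda>n. - (X n - X' n)) \<longlonglongrightarrow> - 0" by (rule tendsto_minus)
  then show "(\<lambda>n. - X n - - X' n) \<longlonglongrightarrow> 0" by simp
qed

definition minus_completion :: "'a completion \<Rightarrow> 'a completion \<Rightarrow> 'a completion"
  where "minus_completion x y = x + - y"

lift_definition scaleR_completion :: "real \<Rightarrow> 'a completion \<Rightarrow> 'a completion"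
  is "\<lambda>r X n. r *\<^sub>R X n"
  unfolding cauchy_rel_def
proof (elim conjE, intro conjI Cauchy_scaleR)
  fix r and X X' :: "nat \<Rightarrow> 'a"
  assume "(\<lambda>n. X n - X' n) \<longlonglongrightarrow> 0"
  then have "(\<lambda>n. r *\<^sub>R (X n - X' n)) \<longlonglongrightarrow> r *\<^sub>R 0" by (intro tendsto_intros)
  then show "(\<lambda>n. r *\<^sub>R X n - r *\<^sub>R X' n) \<longlonglongrightarrow> 0" by (simp add: algebra_simps)
qed

lift_definition norm_completion :: "'a completion \<Rightarrow> real" is "\<lambda>X. lim (\<lambda>n. norm (X n))"
proof -
  fix X Y :: "nat \<Rightarrow> 'a" assume a: "cauchy_rel X Y"
  have "(\<lambda>n. norm (X n) - norm (Y n)) \<longlonglongrightarrow> 0"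
  proof (rule Lim_null_comparison)
    show "\<forall>\<^sub>F n in sequentially. norm (norm (X n) - norm (Y n)) \<le> norm (X n - Y n)"
      by (simp add: norm_triangle_ineq3)
    show "(\<lambda>n. norm (X n - Y n)) \<longlonglongrightarrow> 0"
      using a unfolding cauchy_rel_def by (auto intro: tendsto_norm_zero)
  qed
  moreover have "(\<lambda>n. norm (X n) - norm (Y n)) \<longlonglongrightarrow> lim (\<lambda>n. norm (X n)) - lim (\<lambda>n. norm (Y n))"
    using a unfolding cauchy_rel_def by (intro tendsto_diff Cauchy_norm_tendsto) auto
  ultimately show "lim (\<lambda>n. norm (X n)) = lim (\<lambda>n. norm (Y n))"
    using LIMSEQ_unique by fastforce
qed

definition sgn_completion :: "'a completion \<Rightarrow> 'a completion"
  where "sgn_completion x = inverse (norm x) *\<^sub>R x"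

definition dist_completion :: "'a completion \<Rightarrow> 'a completion \<Rightarrow> real"
  where "dist_completion x y = norm (x - y)"

definition uniformity_completion :: "('a completion \<times> 'a completion) filter"
  where "uniformity_completion = (INF e\<in>{0 <..}. principal {(x, y). dist x y < e})"

definition open_completion :: "'a completion set \<Rightarrow> bool"
  where "open_completion U \<longleftrightarrow> (\<forall>x\<in>U. eventually (\<lambda>(x', y). x' = x \<longrightarrow> y \<in> U) uniformity)"

lemma cauchy_relI_eq: "Cauchy X \<Longrightarrow> (\<And>n. X n = Y n) \<Longrightarrow> cauchy_rel X Y"
  for X Y :: "nat \<Rightarrow> 'b::real_normed_vector"
  by (subgoal_tac "X = Y") (auto simp: cauchy_rel_def)

instance
proof
  fix x y z :: "'a completion" and r s :: real
  show "x + y + z = x + (y + z)"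
    by transfer (auto intro!: cauchy_relI_eq Cauchy_add simp: cauchy_rel_def add.assoc)
  show "x + y = y + x"
    by transfer (auto intro!: cauchy_relI_eq Cauchy_add simp: cauchy_rel_def add.commute)
  show "0 + x = x"
    by transfer (simp add: cauchy_rel_def)
  show "- x + x = 0"
    by transfer (auto intro!: cauchy_relI_eq simp: Cauchy_const cauchy_rel_def)
  show "x - y = x + - y" by (simp add: minus_completion_def)
  show "r *\<^sub>R (x + y) = r *\<^sub>R x + r *\<^sub>R y"
    by transfer (auto intro!: cauchy_relI_eq Cauchy_add Cauchy_scaleR simp: cauchy_rel_def scaleR_add_right)
  show "(r + s) *\<^sub>R x = r *\<^sub>R x + s *\<^sub>R x"
    by transfer (auto intro!: cauchy_relI_eq Cauchy_add Cauchy_scaleR simp: cauchy_rel_def scaleR_add_left)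
  show "r *\<^sub>R s *\<^sub>R x = (r * s) *\<^sub>R x"
    by transfer (auto intro!: cauchy_relI_eq Cauchy_add Cauchy_scaleR simp: cauchy_rel_def)
  show "1 *\<^sub>R x = x"
    by transfer (auto simp: cauchy_rel_def)
  show "dist x y = norm (x - y)" by (simp add: dist_completion_def)
  show "sgn x = inverse (norm x) *\<^sub>R x" by (simp add: sgn_completion_def)
  show "uniformity = (INF e\<in>{0 <..}. principal {(x, y :: 'a completion). dist x y < e})"
    by (rule uniformity_completion_def)
  show "open U \<longleftrightarrow> (\<forall>x\<in>U. eventually (\<lambda>(x', y). x' = x \<longrightarrow> y \<in> U) uniformity)"
    for U :: "'a completion set"
    by (rule open_completion_def)
  show "norm x = 0 \<longleftrightarrow> x = 0"
  proof transfer
    fix X :: "nat \<Rightarrow> 'a" assume "cauchy_rel X X"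
    then have c: "Cauchy X" by (simp add: cauchy_rel_def)
    have "lim (\<lambda>n. norm (X n)) = 0 \<longleftrightarrow> (\<lambda>n. norm (X n)) \<longlonglongrightarrow> 0"
      using Cauchy_norm_tendsto[OF c] limI by metis
    also have "\<dots> \<longleftrightarrow> X \<longlonglongrightarrow> 0" by (rule tendsto_norm_zero_iff)
    finally show "lim (\<lambda>n. norm (X n)) = 0 \<longleftrightarrow> cauchy_rel X (\<lambda>_. 0)"
      using c by (simp add: cauchy_rel_def Cauchy_const)
  qed
  show "norm (x + y) \<le> norm x + norm y"
  proof transfer
    fix X Y :: "nat \<Rightarrow> 'a" assume "cauchy_rel X X" "cauchy_rel Y Y"
    then have c: "Cauchy X" "Cauchy Y" by (simp_all add: cauchy_rel_def)
    show "lim (\<lambda>n. norm (X n + Y n)) \<le> lim (\<lambda>n. norm (X n)) + lim (\<lambda>n. norm (Y n))"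
      by (rule LIMSEQ_le[OF Cauchy_norm_tendsto[OF Cauchy_add[OF c]]
            tendsto_add[OF Cauchy_norm_tendsto[OF c(1)] Cauchy_norm_tendsto[OF c(2)]]])
        (auto intro: norm_triangle_ineq)
  qed
  show "norm (r *\<^sub>R x) = \<bar>r\<bar> * norm x"
  proof transfer
    fix r and X :: "nat \<Rightarrow> 'a" assume "cauchy_rel X X"
    then have "(\<lambda>n. \<bar>r\<bar> * norm (X n)) \<longlonglongrightarrow> \<bar>r\<bar> * lim (\<lambda>n. norm (X n))"
      by (intro tendsto_mult_left Cauchy_norm_tendsto) (simp add: cauchy_rel_def)
    then show "lim (\<lambda>n. norm (r *\<^sub>R X n)) = \<bar>r\<bar> * lim (\<lambda>n. norm (X n))"
      by (simp add: limI)
  qed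
qed

end

lift_definition to_completion :: "'a::real_normed_vector \<Rightarrow> 'a completion" is "\<lambda>x _. x"
  by (simp add: cauchy_rel_def Cauchy_const)

lemma norm_to_completion [simp]: "norm (to_completion x) = norm x"
  by transfer simp

lemma linear_to_completion: "linear to_completion"
  by (rule linearI; transfer; simp add: cauchy_rel_def Cauchy_const)

lemma to_completion_tendsto:
  assumes "Cauchy a"
  shows "(\<lambda>n. to_completion (a n)) \<longlonglongrightarrow> abs_completion a"
proof (rule metric_LIMSEQ_I)
  fix e :: real assume e: "0 < e"
  from metric_CauchyD[OF assms, of "e/2"] e obtain K
    where K: "\<And>m n. m \<ge> K \<Longrightarrow> n \<ge> K \<Longrightarrow> dist (a m) (a n) < e/2" by auto
  show "\<exists>no. \<forall>n\<ge>no. dist (to_completion (a n)) (abs_completion a) < e"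
  proof (intro exI[of _ K] allI impI)
    fix n assume n: "n \<ge> K"
    have ra: "cauchy_rel a a" using assms by (simp add: cauchy_rel_def)
    have rm: "cauchy_rel (\<lambda>k. - a k) (\<lambda>k. - a k)"
      using Cauchy_uminus[OF assms] by (simp add: cauchy_rel_def)
    have rc: "cauchy_rel (\<lambda>_. a n) (\<lambda>_. a n)" by (simp add: cauchy_rel_def Cauchy_const)
    have c: "Cauchy (\<lambda>k. a n + - a k)"
      by (intro Cauchy_add Cauchy_uminus Cauchy_const assms)
    then have rd: "cauchy_rel (\<lambda>k. a n + - a k) (\<lambda>k. a n + - a k)"
      by (simp add: cauchy_rel_def)
    have "to_completion (a n) - abs_completion a = abs_completion (\<lambda>k. a n + - a k)"
      by (simp add: minus_completion_def to_completion.abs_eq uminus_completion.abs_eq[OF ra]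
          plus_completion.abs_eq[OF rc rm])
    then have "dist (to_completion (a n)) (abs_completion a) = lim (\<lambda>k. norm (a n + - a k))"
      by (simp only: dist_norm norm_completion.abs_eq[OF rd])
    also have "\<dots> \<le> e/2"
    proof (rule LIMSEQ_le_const2[OF Cauchy_norm_tendsto[OF c]], intro exI[of _ K] allI impI)
      fix k assume "K \<le> k"
      then show "norm (a n + - a k) \<le> e/2" using K[OF n, of k] by (simp add: dist_norm)
    qed
    finally show "dist (to_completion (a n)) (abs_completion a) < e" using e by simp
  qed
qed

lemma to_completion_approx:
  assumes "0 < e"
  shows "\<exists>a. dist x (to_completion a) < e"
proof -
  obtain X where x: "x = abs_completion X" and "cauchy_rel X X"
    by (metis Quotient3_completion Quotient3_rep_reflp Quotient3_abs_rep)
  then have "Cauchy X" by (simp add: cauchy_rel_def)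
  from metric_LIMSEQ_D[OF to_completion_tendsto[OF this] assms]
  show ?thesis using x by (metis dist_commute order_refl)
qed

lemma closure_range_to_completion: "closure (range to_completion) = UNIV"
  using to_completion_approx by (force simp: closure_approachable dist_commute)

instance completion :: (real_normed_vector) banach
proof
  fix X :: "nat \<Rightarrow> 'a completion" assume X: "Cauchy X"
  have "\<exists>a. dist (X n) (to_completion a) < inverse (real (Suc n))" for n
    by (rule to_completion_approx) simp
  then obtain a where a: "\<And>n. dist (X n) (to_completion (a n)) < inverse (real (Suc n))"
    by metis
  have z: "(\<lambda>n. X n - to_completion (a n)) \<longlonglongrightarrow> 0"
    by (rule Lim_null_comparison[OF _ LIMSEQ_inverse_real_of_nat])
      (use a in \<open>auto simp: dist_norm[symmetric] simp del: of_nat_Suc intro!: always_eventually less_imp_le\<close>)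
  have "Cauchy (\<lambda>n. X n + - (X n - to_completion (a n)))"
    by (intro Cauchy_add Cauchy_uminus X convergent_Cauchy) (use z in \<open>auto simp: convergent_def\<close>)
  then have "Cauchy (\<lambda>n. to_completion (a n))" by simp
  then have "Cauchy a"
    unfolding Cauchy_def dist_norm
    by (simp add: linear_diff[OF linear_to_completion, symmetric])
  from tendsto_add[OF z to_completion_tendsto[OF this]]
  show "convergent X" by (auto simp: convergent_def)
qed


section \<open>The space M\<close>

text \<open>The nodes of the tree are the lists over \<^typ>\<open>nat\<close>, ordered by \<^const>\<open>prefix\<close>.\<close>

definition nm_segment :: "nat \<Rightarrow> nat \<Rightarrow> nat list set \<Rightarrow> bool" where
  "nm_segment n m S \<longleftrightarrow>
    (\<exists>s s'. prefix s s' \<and> length s = n \<and> length s' = m \<and> S = {t. prefix s t \<and> prefix t s'})"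

text \<open>Segments are non-empty, so members of a disjoint family are distinct and families can be
  sets of segments. The empty family is allowed; it only contributes the value 0 to the supremum
  of non-negative numbers defining the norm.\<close>

definition admissible :: "nat list set set \<Rightarrow> bool" where
  "admissible F \<longleftrightarrow> finite F \<and> pairwise disjnt F \<and>
    (\<exists>n m. n \<le> m \<and> (\<forall>S\<in>F. nm_segment n m S))"

definition jh_norm :: "(nat list \<Rightarrow> real) \<Rightarrow> real" where
  "jh_norm x = (SUP F\<in>{F. admissible F}. \<Sum>S\<in>F. \<bar>\<Sum>t\<in>S. x t\<bar>)"

text \<open>Finitely nonzero functions vanishing at the root.\<close>

typedef N = "{x :: nat list \<Rightarrow> real. finite {t. x t \<noteq> 0} \<and> x [] = 0}"
  by (rule exI[of _ "\<lambda>_. 0"]) simp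

setup_lifting type_definition_N

lemma finite_segment: "nm_segment n m S \<Longrightarrow> finite S"
  unfolding nm_segment_def by (auto intro: finite_subset[of _ "set (prefixes _)"])

lemma jh_sum_le:
  assumes "admissible F" "finite {t. x t \<noteq> 0}"
  shows "(\<Sum>S\<in>F. \<bar>\<Sum>t\<in>S. x t\<bar>) \<le> (\<Sum>t | x t \<noteq> 0. \<bar>x t :: real\<bar>)"
proof -
  have F: "finite F" "\<And>S. S \<in> F \<Longrightarrow> finite S" "pairwise disjnt F"
    using assms(1) finite_segment unfolding admissible_def by blast+
  have "(\<Sum>S\<in>F. \<bar>\<Sum>t\<in>S. x t\<bar>) \<le> (\<Sum>S\<in>F. \<Sum>t\<in>S. \<bar>x t\<bar>)"
    by (intro sum_mono sum_abs)
  also have "\<dots> = (\<Sum>t\<in>\<Union>F. \<bar>x t\<bar>)"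
    using F by (subst sum.Union_disjoint) (auto simp: pairwise_def disjnt_def)
  also have "\<dots> = (\<Sum>t\<in>\<Union>F \<inter> {t. x t \<noteq> 0}. \<bar>x t\<bar>)"
    using F by (intro sum.mono_neutral_right) auto
  also have "\<dots> \<le> (\<Sum>t | x t \<noteq> 0. \<bar>x t\<bar>)"
    using assms(2) by (intro sum_mono2) auto
  finally show ?thesis .
qed

lemma jh_norm_bdd:
  "finite {t. x t \<noteq> (0::real)} \<Longrightarrow> bdd_above ((\<lambda>F. \<Sum>S\<in>F. \<bar>\<Sum>t\<in>S. x t\<bar>) ` {F. admissible F})"
  by (rule bdd_aboveI[of _ "\<Sum>t | x t \<noteq> 0. \<bar>x t\<bar>"]) (auto intro: jh_sum_le)

lemma jh_norm_upper:
  "finite {t. x t \<noteq> 0} \<Longrightarrow> admissible F \<Longrightarrow> (\<Sum>S\<in>F. \<bar>\<Sum>t\<in>S. x t\<bar>) \<le> jh_norm x"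
  unfolding jh_norm_def by (rule cSUP_upper[OF _ jh_norm_bdd]) auto

lemma admissible_empty: "admissible {}"
  by (auto simp: admissible_def)

lemma jh_norm_least:
  "(\<And>F. admissible F \<Longrightarrow> (\<Sum>S\<in>F. \<bar>\<Sum>t\<in>S. x t\<bar>) \<le> c) \<Longrightarrow> jh_norm x \<le> c"
  unfolding jh_norm_def by (rule cSUP_least) (use admissible_empty in auto)

lemma admissible_singleton: "admissible {{t}}"
proof -
  have "nm_segment (length t) (length t) {t}"
    unfolding nm_segment_def by (intro exI[of _ t]) (auto dest: prefix_order.antisym)
  then show ?thesis by (auto simp: admissible_def)
qed

lemma jh_norm_coord: "finite {t. x t \<noteq> 0} \<Longrightarrow> \<bar>x t\<bar> \<le> jh_norm x"
  using jh_norm_upper[OF _ admissible_singleton[of t], of x] by simp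

lemma jh_norm_scale_le:
  assumes "finite {t. x t \<noteq> 0}"
  shows "jh_norm (\<lambda>t. r * x t) \<le> \<bar>r\<bar> * jh_norm x"
proof (rule jh_norm_least)
  fix F assume "admissible F"
  then have "\<bar>r\<bar> * (\<Sum>S\<in>F. \<bar>\<Sum>t\<in>S. x t\<bar>) \<le> \<bar>r\<bar> * jh_norm x"
    by (intro mult_left_mono jh_norm_upper assms) auto
  then show "(\<Sum>S\<in>F. \<bar>\<Sum>t\<in>S. r * x t\<bar>) \<le> \<bar>r\<bar> * jh_norm x"
    by (simp add: sum_distrib_left[symmetric] abs_mult)
qed

lemma jh_norm_zero: "jh_norm (\<lambda>_. 0) = 0"
  by (rule antisym[OF jh_norm_least]) (use jh_norm_coord[of "\<lambda>_. 0"] in auto)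

lemma jh_norm_scale:
  assumes "finite {t. x t \<noteq> 0}"
  shows "jh_norm (\<lambda>t. r * x t) = \<bar>r\<bar> * jh_norm x"
proof (cases "r = 0")
  case True
  then show ?thesis by (simp add: jh_norm_zero)
next
  case False
  then have f: "finite {t. r * x t \<noteq> 0}" using assms by simp
  have "jh_norm (\<lambda>t. inverse r * (r * x t)) \<le> \<bar>inverse r\<bar> * jh_norm (\<lambda>t. r * x t)"
    by (rule jh_norm_scale_le[OF f])
  then have "\<bar>r\<bar> * jh_norm x \<le> jh_norm (\<lambda>t. r * x t)"
    using False by (simp add: field_simps)
  with jh_norm_scale_le[OF assms, of r] show ?thesis by simp
qed

lemma finite_supp_add:
  "finite {t. x t \<noteq> 0} \<Longrightarrow> finite {t. y t \<noteq> 0} \<Longrightarrow> finite {t. x t + y t \<noteq> (0::real)}"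
  by (rule finite_subset[of _ "{t. x t \<noteq> 0} \<union> {t. y t \<noteq> 0}"]) auto

lemma jh_norm_triangle:
  assumes "finite {t. x t \<noteq> 0}" "finite {t. y t \<noteq> 0}"
  shows "jh_norm (\<lambda>t. x t + y t) \<le> jh_norm x + jh_norm y"
proof (rule jh_norm_least)
  fix F assume F: "admissible F"
  have "(\<Sum>S\<in>F. \<bar>\<Sum>t\<in>S. x t + y t\<bar>) \<le> (\<Sum>S\<in>F. \<bar>\<Sum>t\<in>S. x t\<bar> + \<bar>\<Sum>t\<in>S. y t\<bar>)"
    by (intro sum_mono) (simp add: sum.distrib abs_triangle_ineq)
  also have "\<dots> \<le> jh_norm x + jh_norm y"
    using jh_norm_upper[OF assms(1) F] jh_norm_upper[OF assms(2) F] by (simp add: sum.distrib)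
  finally show "(\<Sum>S\<in>F. \<bar>\<Sum>t\<in>S. x t + y t\<bar>) \<le> jh_norm x + jh_norm y" .
qed

instantiation N :: real_normed_vector
begin

lift_definition zero_N :: N is "\<lambda>_. 0" by simp

lift_definition plus_N :: "N \<Rightarrow> N \<Rightarrow> N" is "\<lambda>x y t. x t + y t"
  by (simp add: finite_supp_add)

lift_definition uminus_N :: "N \<Rightarrow> N" is "\<lambda>x t. - x t" by simp

definition minus_N :: "N \<Rightarrow> N \<Rightarrow> N" where "minus_N x y = x + - y"

lift_definition scaleR_N :: "real \<Rightarrow> N \<Rightarrow> N" is "\<lambda>r x t. r * x t"
  by (auto intro: rev_finite_subset)

lift_definition norm_N :: "N \<Rightarrow> real" is jh_norm .

definition sgn_N :: "N \<Rightarrow> N" where "sgn_N x = inverse (norm x) *\<^sub>R x"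

definition dist_N :: "N \<Rightarrow> N \<Rightarrow> real" where "dist_N x y = norm (x - y)"

definition uniformity_N :: "(N \<times> N) filter"
  where "uniformity_N = (INF e\<in>{0 <..}. principal {(x, y). dist x y < e})"

definition open_N :: "N set \<Rightarrow> bool"
  where "open_N U \<longleftrightarrow> (\<forall>x\<in>U. eventually (\<lambda>(x', y). x' = x \<longrightarrow> y \<in> U) uniformity)"

instance
proof
  fix x y z :: N and r s :: real
  show "x + y + z = x + (y + z)" by transfer (simp add: add.assoc)
  show "x + y = y + x" by transfer (simp add: add.commute)
  show "0 + x = x" by transfer simp
  show "- x + x = 0" by transfer simp
  show "x - y = x + - y" by (simp add: minus_N_def)
  show "r *\<^sub>R (x + y) = r *\<^sub>R x + r *\<^sub>R y" by transfer (simp add: algebra_simps)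
  show "(r + s) *\<^sub>R x = r *\<^sub>R x + s *\<^sub>R x" by transfer (simp add: algebra_simps)
  show "r *\<^sub>R s *\<^sub>R x = (r * s) *\<^sub>R x" by transfer (simp add: mult.assoc)
  show "1 *\<^sub>R x = x" by transfer simp
  show "dist x y = norm (x - y)" by (simp add: dist_N_def)
  show "sgn x = inverse (norm x) *\<^sub>R x" by (simp add: sgn_N_def)
  show "uniformity = (INF e\<in>{0 <..}. principal {(x, y :: N). dist x y < e})"
    by (rule uniformity_N_def)
  show "open U \<longleftrightarrow> (\<forall>x\<in>U. eventually (\<lambda>(x', y). x' = x \<longrightarrow> y \<in> U) uniformity)" for U :: "N set"
    by (rule open_N_def)
  show "norm x = 0 \<longleftrightarrow> x = 0"
  proof transfer
    fix x :: "nat list \<Rightarrow> real"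
    assume "finite {t. x t \<noteq> 0} \<and> x [] = 0"
    then have "\<bar>x t\<bar> \<le> jh_norm x" for t by (simp add: jh_norm_coord)
    then show "jh_norm x = 0 \<longleftrightarrow> x = (\<lambda>_. 0)"
      using jh_norm_zero by fastforce
  qed
  show "norm (x + y) \<le> norm x + norm y" by transfer (simp add: jh_norm_triangle)
  show "norm (r *\<^sub>R x) = \<bar>r\<bar> * norm x" by transfer (simp add: jh_norm_scale)
qed

end

text \<open>As the inclusion of \<^typ>\<open>N\<close> into the space of all finitely nonzero functions is
  isometric, this is, up to isometric isomorphism, the closure of \<^typ>\<open>N\<close> in
  \<open>JH\<^sub>\<infinity>\<close>.\<close>

type_synonym M = "N completion"

end

theory Submission
  imports Defs
begin

text \<open>Fix \<open>k\<close> and \<open>K\<close>. The fan of level \<open>a\<close> puts mass \<open>1/K\<close> on each of \<open>K\<close> children of the node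
  \<open>(k, \<dots>, k)\<close> of length \<open>a\<close>, other than the child continuing this branch. Segments starting right
  at the fan collect its total mass 1. Disjoint segments starting higher up and meeting a fan all
  start on the branch \<open>(k, k, \<dots>)\<close>, so there is only one of them, and it meets only one fan node,
  collecting \<open>1/K\<close>. Hence signed sums of fans of different levels have norm at most \<open>1 + 1/K\<close>.

  If \<open>z\<close> is finitely supported and \<open>k\<close> is fresh for it, the sum \<open>x\<close> of the fans of all levels
  meeting the support satisfies \<open>\<parallel>l x + z\<parallel> \<ge> \<bar>l\<bar> + \<parallel>z\<parallel>\<close>: this gives octahedrality. The root has to be
  excluded because a single segment exhausts the level 0.

  For fixed \<open>K\<close> the fans are weakly null, and a fan \<open>v\<close> below the support of \<open>z\<close> satisfies
  \<open>\<parallel>z \<plusminus> v\<parallel> \<le> max 1 \<parallel>z\<parallel> + 1/K\<close>. So finitely many slices of the ball contain, up to rescaling, points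
  \<open>z \<plusminus> v\<close> with a common \<open>v\<close>, and the functional summing the values at the nodes of that fan is
  close to \<open>\<plusminus> 1\<close> there. Such a functional yields both the diameter of convex combinations of
  slices and the octahedrality of the dual.\<close>

section \<open>Sufficient conditions in general normed spaces\<close>

lemma compact_coefficient_box:
  fixes B :: "'a::real_normed_vector set"
  assumes "finite B"
  shows "compact {\<Sum>b\<in>B. c b *\<^sub>R b | c. \<forall>b\<in>B. \<bar>c b\<bar> \<le> R}"
  using assms
proof induction
  case empty
  then show ?case by simp
next
  case (insert b B)
  let ?X = "\<lambda>B. {\<Sum>b\<in>B. c b *\<^sub>R b | c. \<forall>b\<in>B. \<bar>c b\<bar> \<le> R}"
  \<comment> \<open>The box over one more vector is the sum of a compact segment and the previous
    box, and sums of two compact sets are compact.\<close>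
  have eq: "?X (insert b B) = {u + v | u v. u \<in> (\<lambda>r. r *\<^sub>R b) ` {-R..R} \<and> v \<in> ?X B}"
  proof (intro equalityI subsetI)
    fix y assume "y \<in> ?X (insert b B)"
    then obtain c where c: "y = (\<Sum>b\<in>insert b B. c b *\<^sub>R b)" "\<forall>b\<in>insert b B. \<bar>c b\<bar> \<le> R" by blast
    have "y = c b *\<^sub>R b + (\<Sum>b\<in>B. c b *\<^sub>R b)" using c(1) insert.hyps by simp
    moreover have "c b \<in> {-R..R}" using c(2) by (auto simp: abs_le_iff)
    ultimately show "y \<in> {u + v | u v. u \<in> (\<lambda>r. r *\<^sub>R b) ` {-R..R} \<and> v \<in> ?X B}"
      using c(2) by blast
  next
    fix y assume "y \<in> {u + v | u v. u \<in> (\<lambda>r. r *\<^sub>R b) ` {-R..R} \<and> v \<in> ?X B}"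
    then obtain r c where y: "y = r *\<^sub>R b + (\<Sum>b\<in>B. c b *\<^sub>R b)"
      and r: "r \<in> {-R..R}" and c: "\<forall>b\<in>B. \<bar>c b\<bar> \<le> R" by blast
    have "(\<Sum>x\<in>B. (c(b := r)) x *\<^sub>R x) = (\<Sum>b\<in>B. c b *\<^sub>R b)"
      using insert.hyps by (intro sum.cong) auto
    then have "y = (\<Sum>x\<in>insert b B. (c(b := r)) x *\<^sub>R x)"
      using y insert.hyps by simp
    moreover have "\<forall>x\<in>insert b B. \<bar>(c(b := r)) x\<bar> \<le> R" using r c by (auto simp: abs_le_iff)
    ultimately show "y \<in> ?X (insert b B)" by blast
  qed
  have "compact ((\<lambda>r. r *\<^sub>R b) ` {-R..R})"
    by (intro compact_continuous_image continuous_intros) auto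
  from compact_sums[OF this insert.IH]
  have "compact {u + v | u v. u \<in> (\<lambda>r. r *\<^sub>R b) ` {-R..R} \<and> v \<in> ?X B}" .
  then show ?case unfolding eq .
qed

text \<open>Induction on \<open>B\<close>. A new vector \<open>b\<close> outside
  \<open>span B\<close> has positive distance \<open>d\<close> from that span, which bounds its
  coefficient in \<open>y\<close> by \<open>norm y / d\<close>; the remainder lies in
  \<open>span B\<close>.\<close>

lemma bounded_coefficients:
  fixes B :: "'a::real_normed_vector set"
  assumes "finite B"
  shows "\<exists>C\<ge>0. \<forall>y\<in>span B. \<exists>c. y = (\<Sum>b\<in>B. c b *\<^sub>R b) \<and> (\<forall>b\<in>B. \<bar>c b\<bar> \<le> C * norm y)"
  using assms
proof induction
  case empty
  then show ?case by auto
next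
  case (insert b B)
  then obtain C where C: "C \<ge> 0"
    and coeff: "\<And>y. y \<in> span B \<Longrightarrow> \<exists>c. y = (\<Sum>b\<in>B. c b *\<^sub>R b) \<and> (\<forall>b\<in>B. \<bar>c b\<bar> \<le> C * norm y)"
    by blast
  show ?case
  proof (cases "b \<in> span B")
    case True
    have "\<exists>c. y = (\<Sum>x\<in>insert b B. c x *\<^sub>R x) \<and> (\<forall>x\<in>insert b B. \<bar>c x\<bar> \<le> C * norm y)"
      if "y \<in> span (insert b B)" for y
    proof -
      from that True have "y \<in> span B" by (simp add: span_redundant)
      from coeff[OF this] obtain c where c: "y = (\<Sum>b\<in>B. c b *\<^sub>R b)" "\<forall>b\<in>B. \<bar>c b\<bar> \<le> C * norm y"
        by blast
      have "(\<Sum>x\<in>B. (c(b := 0)) x *\<^sub>R x) = (\<Sum>b\<in>B. c b *\<^sub>R b)"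
        using insert.hyps by (intro sum.cong) auto
      then have "y = (\<Sum>x\<in>insert b B. (c(b := 0)) x *\<^sub>R x)" using c insert.hyps by simp
      then show ?thesis using c C by (intro exI[of _ "c(b := 0)"]) auto
    qed
    then show ?thesis using C by blast
  next
    case False
    \<comment> \<open>Points of \<open>span B\<close> within distance 1 of \<open>b\<close> have
      norm at most \<open>norm b + 1\<close>, so they can be written with coefficients in this box.
      Hence being outside the compact set \<open>Q\<close> keeps \<open>b\<close> away from the
      whole span.\<close>
    define Q where "Q = {\<Sum>x\<in>B. c x *\<^sub>R x | c. \<forall>x\<in>B. \<bar>c x\<bar> \<le> C * (norm b + 1)}"
    have "compact Q" unfolding Q_def by (rule compact_coefficient_box[OF insert.hyps(1)])
    have "Q \<subseteq> span B" unfolding Q_def by (auto intro: span_sum span_scale span_base)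
    then have "b \<notin> Q" using False by auto
    have "open (- Q)" using compact_imp_closed[OF \<open>compact Q\<close>] by blast
    then obtain d0 where d0: "d0 > 0" "ball b d0 \<subseteq> - Q"
      by (rule openE[of _ b]) (use \<open>b \<notin> Q\<close> in auto)
    define d where "d = min d0 1"
    have d: "d > 0" "d \<le> d0" "d \<le> 1" using d0(1) by (auto simp: d_def)
    have far: "d \<le> norm (b - z)" if z: "z \<in> span B" for z
    proof (rule ccontr)
      assume n: "\<not> d \<le> norm (b - z)"
      then have "norm z \<le> norm b + 1"
        using norm_triangle_ineq2[of z b] d by (simp add: norm_minus_commute)
      then have "C * norm z \<le> C * (norm b + 1)" using C by (rule mult_left_mono)
      moreover from coeff[OF z] obtain c
        where "z = (\<Sum>x\<in>B. c x *\<^sub>R x)" "\<forall>x\<in>B. \<bar>c x\<bar> \<le> C * norm z" by blast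
      ultimately have "z \<in> Q" unfolding Q_def by (intro CollectI exI[of _ c]) (meson order_trans)
      then have "z \<notin> ball b d0" using d0(2) by blast
      then have "d0 \<le> norm (b - z)" by (simp add: dist_norm)
      with n d(2) show False by simp
    qed
    \<comment> \<open>The first summand pays for the coefficient of \<open>b\<close>, the second for
      those of the remainder, whose norm is at most
      \<open>(1 + norm b / d) * norm y\<close>.\<close>
    define C' where "C' = 1 / d + C * (1 + norm b / d)"
    have "\<exists>c. y = (\<Sum>x\<in>insert b B. c x *\<^sub>R x) \<and> (\<forall>x\<in>insert b B. \<bar>c x\<bar> \<le> C' * norm y)"
      if "y \<in> span (insert b B)" for y
    proof -
      from that obtain r where r: "y - r *\<^sub>R b \<in> span B" by (auto simp: span_insert)
      have rd: "\<bar>r\<bar> \<le> norm y / d"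
      proof (cases "r = 0")
        case False
        have "(- (1 / r)) *\<^sub>R (y - r *\<^sub>R b) \<in> span B" by (intro span_scale r)
        from far[OF this] have "d \<le> norm ((1 / r) *\<^sub>R y)"
          using False by (simp add: algebra_simps)
        then show ?thesis using d False by (simp add: field_simps)
      qed (use d in auto)
      have "norm (y - r *\<^sub>R b) \<le> norm y + \<bar>r\<bar> * norm b"
        using norm_triangle_ineq4[of y "r *\<^sub>R b"] by simp
      also have "\<dots> \<le> norm y + norm y / d * norm b"
        using rd by (intro add_left_mono mult_right_mono) auto
      finally have nz: "norm (y - r *\<^sub>R b) \<le> (1 + norm b / d) * norm y" by (simp add: algebra_simps)
      from coeff[OF r] obtain c where c: "y - r *\<^sub>R b = (\<Sum>b\<in>B. c b *\<^sub>R b)"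
        "\<forall>x\<in>B. \<bar>c x\<bar> \<le> C * norm (y - r *\<^sub>R b)" by blast
      have "(\<Sum>x\<in>B. (c(b := r)) x *\<^sub>R x) = (\<Sum>b\<in>B. c b *\<^sub>R b)"
        using insert.hyps by (intro sum.cong) auto
      then have eq: "y = (\<Sum>x\<in>insert b B. (c(b := r)) x *\<^sub>R x)"
        using c(1) insert.hyps by (simp add: algebra_simps)
      have C1: "C * norm (y - r *\<^sub>R b) \<le> C * (1 + norm b / d) * norm y"
        using mult_left_mono[OF nz C] by (simp add: mult.assoc)
      have "C * (1 + norm b / d) * norm y \<le> C' * norm y"
        unfolding C'_def using d by (intro mult_right_mono) auto
      moreover have "norm y / d \<le> C' * norm y"
      proof -
        have "1 / d * norm y \<le> C' * norm y"
          unfolding C'_def using d C by (intro mult_right_mono) auto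
        then show ?thesis by simp
      qed
      ultimately have "\<bar>(c(b := r)) x\<bar> \<le> C' * norm y" if "x \<in> insert b B" for x
      proof (cases "x = b")
        case False
        then have "\<bar>c x\<bar> \<le> C * norm (y - r *\<^sub>R b)" using that c(2) by auto
        also note C1
        also note \<open>C * (1 + norm b / d) * norm y \<le> C' * norm y\<close>
        finally show ?thesis using False by simp
      qed (use rd in auto)
      with eq show ?thesis by blast
    qed
    moreover have "C' \<ge> 0" unfolding C'_def using d C by simp
    ultimately show ?thesis by blast
  qed
qed

text \<open>Unit vectors of the span have coefficients bounded by a common \<open>C\<close>, so they
  lie in a compact box, which is totally bounded.\<close>

lemma finite_span_sphere_net:
  fixes B :: "'a::real_normed_vector set"
  assumes "finite B" "e > 0"
  shows "\<exists>A. finite A \<and> (\<forall>y\<in>span B. norm y = 1 \<longrightarrow> (\<exists>z\<in>A. dist z y < e))"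
proof -
  from bounded_coefficients[OF assms(1)] obtain C where
    C: "\<And>y. y \<in> span B \<Longrightarrow> \<exists>c. y = (\<Sum>b\<in>B. c b *\<^sub>R b) \<and> (\<forall>b\<in>B. \<bar>c b\<bar> \<le> C * norm y)" by blast
  let ?Q = "{\<Sum>b\<in>B. c b *\<^sub>R b | c. \<forall>b\<in>B. \<bar>c b\<bar> \<le> C}"
  have "compact ?Q" by (rule compact_coefficient_box[OF assms(1)])
  then obtain A where A: "finite A" "?Q \<subseteq> (\<Union>x\<in>A. ball x e)"
    using assms(2) by (auto simp: compact_eq_totally_bounded)
  have "\<exists>z\<in>A. dist z y < e" if "y \<in> span B" "norm y = 1" for y
  proof -
    have "y \<in> ?Q" using C[OF that(1)] that(2) by auto
    then have "y \<in> (\<Union>x\<in>A. ball x e)" using A(2) by (rule rev_subsetD)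
    then show ?thesis by auto
  qed
  with A(1) show ?thesis by blast
qed

text \<open>By homogeneity only unit vectors of \<open>Y\<close> matter, and a finite net of its
  sphere reduces these to finitely many \<open>z\<close>. Normalising a witness \<open>x\<close> of
  norm at most 1 only enlarges the scalar in front of it.\<close>

lemma octahedral_normI:
  assumes "\<And>A e. finite A \<Longrightarrow> e > 0 \<Longrightarrow>
    \<exists>x::'a::real_normed_vector. norm x \<le> 1 \<and>
      (\<forall>z\<in>A. \<forall>l::real. (1 - e) * \<bar>l\<bar> + norm z - e \<le> norm (l *\<^sub>R x + z))"
  shows "octahedral_norm TYPE('a)"
  unfolding octahedral_norm_def
proof (intro allI impI, elim conjE exE)
  fix \<epsilon> :: real and Y B :: "'a set"
  assume \<epsilon>: "\<epsilon> > 0" and B: "finite B" and Y: "span B = Y"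
  \<comment> \<open>One \<open>e\<close> is the slack of the assumption, one pays for
    \<open>dist z y\<close>, one for \<open>norm z\<close> against 1. The bound \<open>1 / 3\<close>
    keeps \<open>1 - 2 * e\<close> positive.\<close>
  define e where "e = min (\<epsilon> / 3) (1 / 3)"
  have e: "e > 0" "3 * e \<le> \<epsilon>" "e \<le> 1 / 3" using \<epsilon> by (auto simp: e_def)
  from finite_span_sphere_net[OF B e(1)] obtain A where A: "finite A"
    "\<And>y. y \<in> Y \<Longrightarrow> norm y = 1 \<Longrightarrow> \<exists>z\<in>A. dist z y < e" using Y by blast
  \<comment> \<open>The point 0 in the finite set yields \<open>norm x \<ge> 1 - 2 * e\<close>, so
    \<open>x\<close> can be normalised.\<close>
  from assms[of "insert 0 A" e] A(1) e(1) obtain x where x: "norm x \<le> 1"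
    "\<And>z l. z \<in> insert 0 A \<Longrightarrow> (1 - e) * \<bar>l\<bar> + norm z - e \<le> norm (l *\<^sub>R x + z)" by blast
  have x0: "norm x > 0" using x(2)[of 0 1] e by auto
  define u where "u = (1 / norm x) *\<^sub>R x"
  have nu: "norm u = 1" using x0 by (simp add: u_def)
  have unit: "(1 - \<epsilon>) * (\<bar>l\<bar> + 1) \<le> norm (l *\<^sub>R u + y)" if y: "y \<in> Y" "norm y = 1" for l y
  proof -
    from A(2)[OF y] obtain z where z: "z \<in> A" "dist z y < e" by blast
    have "\<bar>l\<bar> \<le> \<bar>l / norm x\<bar>" using x0 x(1) by (simp add: field_simps mult_left_le)
    then have "(1 - e) * \<bar>l\<bar> \<le> (1 - e) * \<bar>l / norm x\<bar>" using e by (intro mult_left_mono) auto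
    also have "\<dots> + norm z - e \<le> norm (l *\<^sub>R u + z)"
      using x(2)[of z "l / norm x"] z(1) by (simp add: u_def)
    also have "norm (l *\<^sub>R u + z) \<le> norm (l *\<^sub>R u + y) + dist z y"
      using norm_triangle_ineq[of "l *\<^sub>R u + y" "z - y"] by (simp add: dist_norm)
    finally have "(1 - e) * \<bar>l\<bar> + norm z - e \<le> norm (l *\<^sub>R u + y) + e" using z(2) by simp
    moreover have "norm z \<ge> 1 - e"
      using norm_triangle_ineq2[of y z] y(2) z(2) by (simp add: dist_norm norm_minus_commute)
    ultimately have "(1 - e) * \<bar>l\<bar> + 1 - 3 * e \<le> norm (l *\<^sub>R u + y)" by simp
    moreover have "(1 - \<epsilon>) * (\<bar>l\<bar> + 1) \<le> (1 - 3 * e) * (\<bar>l\<bar> + 1)"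
      using e by (intro mult_right_mono) auto
    moreover have "(1 - 3 * e) * (\<bar>l\<bar> + 1) \<le> (1 - e) * \<bar>l\<bar> + 1 - 3 * e"
      using e by (simp add: algebra_simps)
    ultimately show ?thesis by linarith
  qed
  have "(1 - \<epsilon>) * (\<bar>l\<bar> + norm y) \<le> norm (l *\<^sub>R u + y)" if y: "y \<in> Y" for l y
  proof (cases "y = 0")
    case True
    then show ?thesis using nu \<epsilon> by (simp add: algebra_simps)
  next
    case False
    let ?r = "norm y"
    have r: "?r > 0" using False by simp
    have "(1 / ?r) *\<^sub>R y \<in> Y" using y Y by (auto intro: span_scale)
    from unit[OF this, of "l / ?r"] r
    have "?r * ((1 - \<epsilon>) * (\<bar>l / ?r\<bar> + 1)) \<le> ?r * norm ((l / ?r) *\<^sub>R u + (1 / ?r) *\<^sub>R y)"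
      by (intro mult_left_mono) auto
    also have "\<dots> = norm (?r *\<^sub>R ((l / ?r) *\<^sub>R u + (1 / ?r) *\<^sub>R y))" by simp
    also have "?r *\<^sub>R ((l / ?r) *\<^sub>R u + (1 / ?r) *\<^sub>R y) = l *\<^sub>R u + y"
      using r by (simp add: scaleR_add_right)
    also have "?r * ((1 - \<epsilon>) * (\<bar>l / ?r\<bar> + 1)) = (1 - \<epsilon>) * (\<bar>l\<bar> + ?r)"
      using r by (simp add: field_simps)
    finally show ?thesis .
  qed
  with nu show "\<exists>x. norm x = 1 \<and> (\<forall>y\<in>Y. \<forall>l. (1 - \<epsilon>) * (\<bar>l\<bar> + norm y) \<le> norm (l *\<^sub>R x + y))"
    by blast
qed

text \<open>A single \<open>g\<close> serves all slices: averaging points with \<open>g\<close> near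
  1, and points with \<open>g\<close> near -1, gives two elements of the convex combination at
  distance almost 2.\<close>

lemma strong_diameter_twoI:
  assumes sep: "\<And>\<S> e. finite \<S> \<Longrightarrow> (\<forall>S\<in>\<S>. is_slice_of S (cball 0 1)) \<Longrightarrow> e > 0 \<Longrightarrow>
    \<exists>g::'a::real_normed_vector \<Rightarrow>\<^sub>L real. norm g \<le> 1 \<and>
      (\<forall>S\<in>\<S>. (\<exists>a\<in>S. 1 - e \<le> blinfun_apply g a) \<and> (\<exists>b\<in>S. blinfun_apply g b \<le> e - 1))"
  shows "strong_diameter_two TYPE('a)"
  unfolding strong_diameter_two_def
proof (intro allI impI, elim conjE)
  fix n :: nat and S :: "nat \<Rightarrow> 'a set" and l :: "nat \<Rightarrow> real"
  assume S: "\<forall>i<n. is_slice_of (S i) (cball 0 1)" and l: "\<forall>i<n. 0 \<le> l i" "(\<Sum>i<n. l i) = 1"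
  let ?D = "{(\<Sum>i<n. l i *\<^sub>R s i) | s. \<forall>i<n. s i \<in> S i}"
  have sub: "S i \<subseteq> cball 0 1" if "i < n" for i
    using S that by (auto simp: is_slice_of_def slice_def)
  have "?D \<subseteq> cball 0 1"
  proof
    fix y assume "y \<in> ?D"
    then obtain s where s: "y = (\<Sum>i<n. l i *\<^sub>R s i)" "\<forall>i<n. s i \<in> S i" by blast
    have "norm y \<le> (\<Sum>i<n. l i * 1)"
      unfolding s(1)
    proof (rule sum_norm_le)
      fix i assume "i \<in> {..<n}"
      then have "norm (s i) \<le> 1" "0 \<le> l i" using s(2) sub l by (auto simp: subset_iff)
      then show "norm (l i *\<^sub>R s i) \<le> l i * 1" by (simp add: mult_left_le)
    qed
    then show "y \<in> cball 0 1" using l by simp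
  qed
  then have bound: "\<And>y. y \<in> ?D \<Longrightarrow> norm y \<le> 1" by (auto simp: subset_iff)
  then have bd: "bounded ?D" unfolding bounded_iff by blast
  have "diameter ?D \<le> 2"
  proof (rule diameter_le)
    fix y z assume "y \<in> ?D" "z \<in> ?D"
    then show "norm (y - z) \<le> 2" using bound[of y] bound[of z] norm_triangle_ineq4[of y z] by linarith
  qed simp
  moreover have "2 \<le> diameter ?D + e" if e: "e > 0" for e
  proof -
    from sep[of "S ` {..<n}" "e / 2"] S e obtain g :: "'a \<Rightarrow>\<^sub>L real" where g: "norm g \<le> 1"
      "\<forall>i<n. (\<exists>a\<in>S i. 1 - e / 2 \<le> g a) \<and> (\<exists>b\<in>S i. g b \<le> e / 2 - 1)" by auto
    then obtain a b where a: "\<And>i. i < n \<Longrightarrow> a i \<in> S i" "\<And>i. i < n \<Longrightarrow> 1 - e / 2 \<le> g (a i)"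
      and b: "\<And>i. i < n \<Longrightarrow> b i \<in> S i" "\<And>i. i < n \<Longrightarrow> g (b i) \<le> e / 2 - 1"
      by metis
    let ?a = "\<Sum>i<n. l i *\<^sub>R a i" and ?b = "\<Sum>i<n. l i *\<^sub>R b i"
    have "2 - e = (\<Sum>i<n. l i * (2 - e))" using l(2) by (simp flip: sum_distrib_right)
    also have "\<dots> \<le> (\<Sum>i<n. l i * (g (a i) - g (b i)))"
    proof (intro sum_mono mult_left_mono)
      fix i assume "i \<in> {..<n}"
      then show "2 - e \<le> g (a i) - g (b i)" "0 \<le> l i" using a(2)[of i] b(2)[of i] l by auto
    qed
    also have "\<dots> = g (?a - ?b)"
      by (simp add: blinfun.diff_right blinfun.sum_right blinfun.scaleR_right right_diff_distrib sum_subtractf)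
    also have "\<dots> \<le> norm g * norm (?a - ?b)" using norm_blinfun[of g "?a - ?b"] by simp
    also have "\<dots> \<le> norm (?a - ?b)" using g(1) by (simp add: mult_left_le_one_le)
    also have "\<dots> \<le> diameter ?D"
      using diameter_bounded_bound[OF bd, of ?a ?b] a(1) b(1) by (fastforce simp: dist_norm)
    finally show ?thesis by simp
  qed
  then have "2 \<le> diameter ?D" by (rule field_le_epsilon)
  ultimately show "diameter ?D = 2" by simp
qed

section \<open>Slices of the unit ball and the norm of the dual\<close>

lemma blinfun_le_slice_bound:
  fixes f :: "'a::real_normed_vector \<Rightarrow>\<^sub>L real"
  assumes "x \<in> slice (cball 0 1) f e"
  shows "norm f - e \<le> f x"
proof -
  let ?s = "SUP y\<in>cball 0 1. blinfun_apply f y"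
  have bdd: "bdd_above (blinfun_apply f ` cball 0 1)"
  proof (rule bdd_aboveI2)
    fix y :: 'a assume "y \<in> cball 0 1"
    then have "norm f * norm y \<le> norm f" by (simp add: mult_left_le)
    then show "f y \<le> norm f" using norm_blinfun[of f y] by simp
  qed
  have up: "f y \<le> ?s" if "norm y \<le> 1" for y
    using that by (intro cSUP_upper bdd) auto
  have "norm f \<le> ?s"
  proof (rule norm_blinfun_bound)
    show "0 \<le> ?s" using up[of 0] by (simp add: blinfun.zero_right)
    fix y :: 'a
    show "norm (f y) \<le> ?s * norm y"
    proof (cases "y = 0")
      case False
      \<comment> \<open>Both \<open>sgn y\<close> and \<open>- sgn y\<close> lie in the ball, so the
        supremum of \<open>f\<close>, taken without modulus, still bounds the modulus.\<close>
      have "\<bar>f (sgn y)\<bar> \<le> ?s"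
        using up[of "sgn y"] up[of "- sgn y"] by (auto simp: norm_sgn blinfun.minus_right abs_le_iff)
      moreover have "f (sgn y) = f y / norm y"
        by (simp add: sgn_div_norm blinfun.scaleR_right divide_inverse mult.commute)
      ultimately show ?thesis using False by (simp add: abs_divide divide_le_eq)
    qed (simp add: blinfun.zero_right)
  qed
  with assms show ?thesis by (simp add: slice_def)
qed

text \<open>On the slice cut out by \<open>f\<close>, the value of \<open>f\<close> is at least
  \<open>norm f - e\<close>. Evaluating \<open>l *\<^sub>R g + f\<close> at a point of it where
  \<open>g\<close> is near 1 or near -1, according to the sign of \<open>l\<close>, gives almost
  \<open>\<bar>l\<bar> + norm f\<close>.\<close>

lemma octahedral_norm_dualI:
  assumes sep: "\<And>\<S> e. finite \<S> \<Longrightarrow> (\<forall>S\<in>\<S>. is_slice_of S (cball 0 1)) \<Longrightarrow> e > 0 \<Longrightarrow>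
    \<exists>g::'a::real_normed_vector \<Rightarrow>\<^sub>L real. norm g \<le> 1 \<and>
      (\<forall>S\<in>\<S>. (\<exists>a\<in>S. 1 - e \<le> blinfun_apply g a) \<and> (\<exists>b\<in>S. blinfun_apply g b \<le> e - 1))"
  shows "octahedral_norm TYPE('a \<Rightarrow>\<^sub>L real)"
proof (rule octahedral_normI)
  fix A :: "('a \<Rightarrow>\<^sub>L real) set" and e :: real
  assume A: "finite A" and e: "e > 0"
  have "\<forall>S\<in>(\<lambda>f. slice (cball 0 1) f e) ` A. is_slice_of S (cball 0 1)"
    using e by (auto simp: is_slice_of_def)
  from sep[OF _ this e] A obtain g :: "'a \<Rightarrow>\<^sub>L real" where g: "norm g \<le> 1"
    "\<And>f. f \<in> A \<Longrightarrow> \<exists>a\<in>slice (cball 0 1) f e. 1 - e \<le> g a"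
    "\<And>f. f \<in> A \<Longrightarrow> \<exists>b\<in>slice (cball 0 1) f e. g b \<le> e - 1" by auto
  have "(1 - e) * \<bar>l\<bar> + norm f - e \<le> norm (l *\<^sub>R g + f)" if f: "f \<in> A" for f l
  proof -
    have "\<exists>x\<in>slice (cball 0 1) f e. (1 - e) * \<bar>l\<bar> \<le> l * g x"
    proof (cases "l \<ge> 0")
      case True
      then show ?thesis using g(2)[OF f] mult_left_mono[OF _ True] by (force simp: mult.commute)
    next
      case False
      then have l: "l \<le> 0" by simp
      from g(3)[OF f] obtain b where b: "b \<in> slice (cball 0 1) f e" "g b \<le> e - 1" by blast
      from mult_left_mono_neg[OF b(2) l] b(1) l show ?thesis
        by (intro bexI[of _ b]) (auto simp: algebra_simps)
    qed
    then obtain x where x: "x \<in> slice (cball 0 1) f e" "(1 - e) * \<bar>l\<bar> \<le> l * g x" by blast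
    have "(1 - e) * \<bar>l\<bar> + norm f - e \<le> (l *\<^sub>R g + f) x"
      using x(2) blinfun_le_slice_bound[OF x(1)] by (simp add: blinfun.add_left blinfun.scaleR_left)
    also have "\<dots> \<le> norm (l *\<^sub>R g + f) * norm x" using norm_blinfun[of "l *\<^sub>R g + f" x] by simp
    also have "\<dots> \<le> norm (l *\<^sub>R g + f)" using x(1) by (intro mult_left_le) (auto simp: slice_def)
    finally show ?thesis .
  qed
  with g(1) show "\<exists>x. norm x \<le> 1 \<and>
      (\<forall>z\<in>A. \<forall>l. (1 - e) * \<bar>l\<bar> + norm z - e \<le> norm (l *\<^sub>R x + z))" by blast
qed


section \<open>Extending functionals to the completion\<close>

lemma blinfun_Cauchy_lim:
  fixes g :: "'a::real_normed_vector \<Rightarrow>\<^sub>L 'b::banach"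
  assumes "Cauchy X"
  shows "(\<lambda>n. blinfun_apply g (X n)) \<longlonglongrightarrow> lim (\<lambda>n. blinfun_apply g (X n))"
  using bounded_linear.Cauchy[OF blinfun.bounded_linear_right assms, of g]
  by (simp add: Cauchy_convergent_iff convergent_LIMSEQ_iff)

lift_definition completion_extend ::
    "('a::real_normed_vector \<Rightarrow>\<^sub>L 'b::banach) \<Rightarrow> 'a completion \<Rightarrow> 'b"
  is "\<lambda>g X. lim (\<lambda>n. blinfun_apply g (X n))"
proof -
  fix g :: "'a \<Rightarrow>\<^sub>L 'b" and X Y :: "nat \<Rightarrow> 'a"
  assume a: "cauchy_rel X Y"
  then have "(\<lambda>n. g (X n - Y n)) \<longlonglongrightarrow> g 0"
    unfolding cauchy_rel_def by (intro tendsto_intros) auto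
  then have "(\<lambda>n. g (X n) - g (Y n)) \<longlonglongrightarrow> 0"
    by (simp add: blinfun.diff_right blinfun.zero_right)
  moreover have "(\<lambda>n. g (X n) - g (Y n)) \<longlonglongrightarrow> lim (\<lambda>n. g (X n)) - lim (\<lambda>n. g (Y n))"
    using a unfolding cauchy_rel_def by (intro tendsto_diff blinfun_Cauchy_lim) auto
  ultimately show "lim (\<lambda>n. g (X n)) = lim (\<lambda>n. g (Y n))"
    using LIMSEQ_unique by fastforce
qed

text \<open>Bounded operators map Cauchy sequences to Cauchy sequences; limits along representatives
  define the extension, and the norm bound passes to the limit. This turns functionals on
  \<open>N\<close> into elements of the dual of \<open>M\<close>.\<close>

lemma blinfun_extend_completion:
  fixes g :: "'a::real_normed_vector \<Rightarrow>\<^sub>L 'b::banach"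
  shows "\<exists>G :: 'a completion \<Rightarrow>\<^sub>L 'b.
    (\<forall>x. blinfun_apply G (to_completion x) = blinfun_apply g x) \<and> norm G \<le> norm g"
proof -
  let ?G = "completion_extend g"
  have le: "norm (?G x) \<le> norm g * norm x" for x
  proof (transfer fixing: g)
    fix X :: "nat \<Rightarrow> 'a" assume "cauchy_rel X X"
    then have c: "Cauchy X" by (simp add: cauchy_rel_def)
    show "norm (lim (\<lambda>n. g (X n))) \<le> norm g * lim (\<lambda>n. norm (X n))"
      by (rule LIMSEQ_le[OF tendsto_norm[OF blinfun_Cauchy_lim[OF c]]
            tendsto_mult_left[OF Cauchy_norm_tendsto[OF c]]])
        (auto intro: norm_blinfun)
  qed
  have "bounded_linear ?G"
  proof (rule bounded_linear_intro)
    show "?G (x + y) = ?G x + ?G y" for x y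
      by transfer (auto simp: blinfun.add_right cauchy_rel_def
          intro!: limI tendsto_add blinfun_Cauchy_lim)
    show "?G (r *\<^sub>R x) = r *\<^sub>R ?G x" for r x
      by transfer (auto simp: blinfun.scaleR_right cauchy_rel_def
          intro!: limI tendsto_scaleR blinfun_Cauchy_lim)
    show "norm (?G x) \<le> norm x * norm g" for x using le[of x] by (simp add: mult.commute)
  qed
  then have app: "blinfun_apply (Blinfun ?G) = ?G" by (rule bounded_linear_Blinfun_apply)
  have "?G (to_completion x) = g x" for x
    by transfer simp
  moreover have "norm (Blinfun ?G) \<le> norm g"
    by (rule norm_blinfun_bound) (use le in \<open>auto simp: app\<close>)
  ultimately show ?thesis by (intro exI[of _ "Blinfun ?G"]) (simp add: app)
qed


section \<open>Fans\<close>

text \<open>The last entry of a fan node exceeds \<open>k\<close>, so that for fixed \<open>k\<close> the fan nodes of all levels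
  form an antichain: a segment meets at most one of them.\<close>

definition fan_nodes :: "nat \<Rightarrow> nat \<Rightarrow> nat \<Rightarrow> nat list set" where
  "fan_nodes k K a = (\<lambda>i. replicate a k @ [i]) ` {k<..k + K}"

lemma finite_fan_nodes: "finite (fan_nodes k K a)"
  by (simp add: fan_nodes_def)

lemma card_fan_nodes: "card (fan_nodes k K a) = K"
  unfolding fan_nodes_def by (subst card_image) (auto simp: inj_on_def)

lemma length_fan_nodes: "t \<in> fan_nodes k K a \<Longrightarrow> length t = Suc a"
  by (auto simp: fan_nodes_def)

lemma fan_nodes_take:
  "t \<in> fan_nodes k K a \<Longrightarrow> n \<le> a \<Longrightarrow> take n t = replicate n k"
  by (auto simp: fan_nodes_def)

lemma fan_nodes_antichain:
  assumes t: "t \<in> fan_nodes k K a" and u: "u \<in> fan_nodes k K b" and "prefix t u"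
  shows "t = u"
proof -
  have le: "a \<le> b" using prefix_length_le[OF \<open>prefix t u\<close>] t u by (simp add: length_fan_nodes)
  show ?thesis
  proof (cases "a = b")
    case True
    then have "length t = length u" using t u by (simp add: length_fan_nodes)
    then show ?thesis using \<open>prefix t u\<close> by (auto simp: prefix_def)
  next
    case False
    \<comment> \<open>For \<open>a < b\<close> the prefix of \<open>u\<close> of length
      \<open>Suc a\<close> is still on the constant branch and ends in \<open>k\<close>, while
      \<open>t\<close> ends in an entry above \<open>k\<close>.\<close>
    have "t = take (Suc a) u" using \<open>prefix t u\<close> length_fan_nodes[OF t] by (auto simp: prefix_def)
    then have "t = replicate (Suc a) k" using fan_nodes_take[OF u, of "Suc a"] le False by simp
    moreover obtain i where "i > k" "t = replicate a k @ [i]" using t by (auto simp: fan_nodes_def)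
    ultimately show ?thesis by (simp add: replicate_append_same[symmetric])
  qed
qed

section \<open>Segments and what they collect from fans\<close>

lemma segment_take:
  assumes "nm_segment n m S" "t \<in> S"
  shows "n \<le> length t" "take n t \<in> S"
proof -
  obtain s s' where s: "prefix s s'" "length s = n" "S = {t. prefix s t \<and> prefix t s'}"
    using assms(1) unfolding nm_segment_def by blast
  then have p: "prefix s t" "prefix t s'" using assms(2) by auto
  show "n \<le> length t" using prefix_length_le[OF p(1)] s(2) by simp
  have "take n t = s" using p(1) s(2) by (auto simp: prefix_def)
  then show "take n t \<in> S" using s by simp
qed

lemma segment_chain:
  "nm_segment n m S \<Longrightarrow> t \<in> S \<Longrightarrow> u \<in> S \<Longrightarrow> prefix t u \<or> prefix u t"
  unfolding nm_segment_def by (auto dest: prefix_same_cases)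

text \<open>A segment is a chain and the fan nodes form an antichain, so at most one node of the
  segment carries a nonzero value.\<close>

lemma segment_fan_sum:
  fixes u :: "nat list \<Rightarrow> real"
  assumes S: "nm_segment n m S" and supp: "\<And>t. u t \<noteq> 0 \<Longrightarrow> \<exists>a. t \<in> fan_nodes k K a"
    and t: "t \<in> S" "u t \<noteq> 0"
  shows "sum u S = u t"
proof -
  have "u v = 0" if v: "v \<in> S - {t}" for v
  proof (rule ccontr)
    assume "u v \<noteq> 0"
    with supp t(2) obtain a b where "v \<in> fan_nodes k K a" "t \<in> fan_nodes k K b" by blast
    moreover have "prefix v t \<or> prefix t v" using segment_chain[OF S] t(1) v by blast
    ultimately have "v = t" using fan_nodes_antichain by metis
    with v show False by simp
  qed
  then have "sum u S = sum u {t}" using t finite_segment[OF S] by (intro sum.mono_neutral_right) auto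
  then show ?thesis by simp
qed

text \<open>Segments starting at level \<open>n\<close> and meeting a fan at a deeper level all start at the node
  \<open>replicate n k\<close>, so a disjoint family contains at most one of them.\<close>

lemma fan_sum_le:
  fixes u :: "nat list \<Rightarrow> real"
  assumes F: "finite F" "pairwise disjnt F" "\<forall>S\<in>F. nm_segment n m S"
    and supp: "\<And>t. u t \<noteq> 0 \<Longrightarrow> \<exists>a\<ge>L. t \<in> fan_nodes k K a"
    and bound: "\<And>t. \<bar>u t\<bar> \<le> 1 / real K"
  shows fan_sum_le_deep: "n \<le> L \<Longrightarrow> (\<Sum>S\<in>F. \<bar>\<Sum>t\<in>S. u t\<bar>) \<le> 1 / real K"
    and fan_sum_le_any: "(\<Sum>S\<in>F. \<bar>\<Sum>t\<in>S. u t\<bar>) \<le> 1 + 1 / real K"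
proof -
  define c where "c = replicate n k"
  \<comment> \<open>By disjointness at most one member contains the branch node \<open>c\<close>,
    and it collects at most \<open>1 / real K\<close>.\<close>
  define F1 where "F1 = {S\<in>F. c \<in> S}"
  define F2 where "F2 = {S\<in>F. c \<notin> S}"
  have split: "(\<Sum>S\<in>F. \<bar>\<Sum>t\<in>S. u t\<bar>) = (\<Sum>S\<in>F1. \<bar>\<Sum>t\<in>S. u t\<bar>) + (\<Sum>S\<in>F2. \<bar>\<Sum>t\<in>S. u t\<bar>)"
    unfolding F1_def F2_def using F(1) by (subst sum.union_disjoint[symmetric]) (auto intro: sum.cong)
  have le1: "\<bar>\<Sum>t\<in>S. u t\<bar> \<le> 1 / real K" if "S \<in> F" for S
  proof (cases "\<exists>t\<in>S. u t \<noteq> 0")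
    case True
    then obtain t where "t \<in> S" "u t \<noteq> 0" by blast
    then have "sum u S = u t" using segment_fan_sum[of n m S u k K t] F(3) that supp by blast
    then show ?thesis using bound by simp
  qed simp
  have "card F1 \<le> Suc 0"
    using F(1,2) by (auto simp: F1_def card_le_Suc0_iff_eq pairwise_def disjnt_def)
  have "(\<Sum>S\<in>F1. \<bar>\<Sum>t\<in>S. u t\<bar>) \<le> real (card F1) * (1 / real K)"
    using le1 by (intro sum_bounded_above) (auto simp: F1_def)
  also have "\<dots> \<le> 1 * (1 / real K)"
    using \<open>card F1 \<le> Suc 0\<close> by (intro mult_right_mono) auto
  finally have s1: "(\<Sum>S\<in>F1. \<bar>\<Sum>t\<in>S. u t\<bar>) \<le> 1 / real K" by simp
  \<comment> \<open>A segment missing \<open>c\<close> can meet a fan only at its first node, since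
    a fan node of level \<open>a \<ge> n\<close> would force \<open>c\<close> into the segment. So
    only the fan of level \<open>n - 1\<close> counts.\<close>
  have F2: "\<exists>a. a \<ge> L \<and> n = Suc a \<and> t \<in> fan_nodes k K a"
    if S: "S \<in> F2" and t: "t \<in> S" "u t \<noteq> 0" for S t
  proof -
    from supp[OF t(2)] obtain a where a: "a \<ge> L" "t \<in> fan_nodes k K a" by blast
    have seg: "nm_segment n m S" using S F(3) by (auto simp: F2_def)
    have "n \<le> Suc a" using segment_take(1)[OF seg t(1)] length_fan_nodes[OF a(2)] by simp
    moreover have "\<not> n \<le> a"
      using segment_take(2)[OF seg t(1)] fan_nodes_take[OF a(2), of n] S by (auto simp: F2_def c_def)
    ultimately show ?thesis using a by auto
  qed
  {
    assume "n \<le> L"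
    then have "u t = 0" if "S \<in> F2" "t \<in> S" for S t using F2[OF that] by force
    then have "(\<Sum>S\<in>F2. \<bar>\<Sum>t\<in>S. u t\<bar>) = 0" by simp
    then show "(\<Sum>S\<in>F. \<bar>\<Sum>t\<in>S. u t\<bar>) \<le> 1 / real K" using split s1 by simp
  }
  have fin: "finite S" if "S \<in> F2" for S using that F(3) finite_segment by (auto simp: F2_def)
  have "(\<Sum>S\<in>F2. \<bar>\<Sum>t\<in>S. u t\<bar>) \<le> (\<Sum>S\<in>F2. \<Sum>t\<in>S. \<bar>u t\<bar>)"
    by (intro sum_mono sum_abs)
  also have "\<dots> = (\<Sum>t\<in>\<Union>F2. \<bar>u t\<bar>)"
    using fin F(2) by (subst sum.Union_disjoint) (auto simp: F2_def pairwise_def disjnt_def)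
  \<comment> \<open>For \<open>n = 0\<close> the function \<open>u\<close> vanishes on all members
    of \<open>F2\<close>, so the truncated \<open>n - 1\<close> does no harm.\<close>
  also have "\<dots> = (\<Sum>t\<in>\<Union>F2 \<inter> fan_nodes k K (n - 1). \<bar>u t\<bar>)"
  proof (rule sum.mono_neutral_right)
    show "finite (\<Union>F2)" using fin F(1) by (auto simp: F2_def)
    show "\<forall>t\<in>\<Union>F2 - \<Union>F2 \<inter> fan_nodes k K (n - 1). \<bar>u t\<bar> = 0" using F2 by fastforce
  qed auto
  also have "\<dots> \<le> (\<Sum>t\<in>fan_nodes k K (n - 1). \<bar>u t\<bar>)"
    by (intro sum_mono2 finite_fan_nodes) auto
  also have "\<dots> \<le> real (card (fan_nodes k K (n - 1))) * (1 / real K)"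
    using bound by (intro sum_bounded_above)
  also have "\<dots> \<le> 1" by (simp add: card_fan_nodes)
  finally show "(\<Sum>S\<in>F. \<bar>\<Sum>t\<in>S. u t\<bar>) \<le> 1 + 1 / real K" using split s1 by simp
qed

section \<open>Fans as vectors of \<open>N\<close> and the norm of their combinations\<close>

lift_definition fan :: "nat \<Rightarrow> nat \<Rightarrow> nat \<Rightarrow> N" is
  "\<lambda>k K a t. if t \<in> fan_nodes k K a then 1 / real K else 0"
proof
  fix k K a :: nat
  show "finite {t. (if t \<in> fan_nodes k K a then 1 / real K else 0) \<noteq> 0}"
    by (rule finite_subset[OF _ finite_fan_nodes[of k K a]]) auto
  show "(if [] \<in> fan_nodes k K a then 1 / real K else 0) = 0" by (auto simp: fan_nodes_def)
qed

lemma finite_support_N: "finite {t. Rep_N x t \<noteq> 0}" and Rep_N_Nil: "Rep_N x [] = 0"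
  using Rep_N[of x] by auto

lemma Rep_N_sum: "Rep_N (\<Sum>a\<in>A. f a) t = (\<Sum>a\<in>A. Rep_N (f a) t)"
  by (induction A rule: infinite_finite_induct) (auto simp: zero_N.rep_eq plus_N.rep_eq)

lemma Rep_N_fans:
  assumes "finite A" "t \<in> fan_nodes k K b"
  shows "Rep_N (\<Sum>a\<in>A. c a *\<^sub>R fan k K a) t = (if b \<in> A then c b / real K else 0)"
proof -
  have "t \<in> fan_nodes k K a \<longleftrightarrow> a = b" for a
    using assms(2) length_fan_nodes[of t k K a] length_fan_nodes[of t k K b] by auto
  then have "Rep_N (\<Sum>a\<in>A. c a *\<^sub>R fan k K a) t = (\<Sum>a\<in>A. if a = b then c a / real K else 0)"
    by (auto simp: Rep_N_sum scaleR_N.rep_eq fan.rep_eq intro!: sum.cong)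
  then show ?thesis using assms(1) by simp
qed

lemma Rep_N_fans_0:
  assumes "\<And>a. a \<in> A \<Longrightarrow> t \<notin> fan_nodes k K a"
  shows "Rep_N (\<Sum>a\<in>A. c a *\<^sub>R fan k K a) t = 0"
  using assms by (auto simp: Rep_N_sum scaleR_N.rep_eq fan.rep_eq intro!: sum.neutral)

text \<open>Families starting at a level \<open>n \<le> L\<close> see \<open>x\<close> but only
  \<open>1 / real K\<close> of the fans; families starting deeper see nothing of \<open>x\<close>
  and at most \<open>1 + 1 / real K\<close> of the fans. Hence a maximum instead of a sum.\<close>

lemma norm_add_fans_le:
  assumes K: "K > 0" and A: "finite A" "A \<subseteq> {L..}" and c: "\<And>a. a \<in> A \<Longrightarrow> \<bar>c a\<bar> \<le> 1"
    and x: "\<And>t. Rep_N x t \<noteq> 0 \<Longrightarrow> length t \<le> L"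
  shows "norm (x + (\<Sum>a\<in>A. c a *\<^sub>R fan k K a)) \<le> max 1 (norm x) + 1 / real K"
proof -
  define u where "u = Rep_N (\<Sum>a\<in>A. c a *\<^sub>R fan k K a)"
  have supp: "\<exists>a\<ge>L. t \<in> fan_nodes k K a" if "u t \<noteq> 0" for t
    using that Rep_N_fans_0[of A t k K c] A(2) unfolding u_def by blast
  have bound: "\<bar>u t\<bar> \<le> 1 / real K" for t
  proof (cases "\<exists>b. t \<in> fan_nodes k K b")
    case True
    then obtain b where "t \<in> fan_nodes k K b" by blast
    then show ?thesis using Rep_N_fans[OF A(1), of t k K b c] c[of b] K
      by (auto simp: u_def abs_divide divide_right_mono)
  next
    case False
    then have "u t = 0" unfolding u_def by (intro Rep_N_fans_0) blast
    then show ?thesis by simp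
  qed
  have "jh_norm (\<lambda>t. Rep_N x t + u t) \<le> max 1 (norm x) + 1 / real K"
  proof (rule jh_norm_least)
    fix F assume F: "admissible F"
    then obtain n m where nm: "finite F" "pairwise disjnt F" "\<forall>S\<in>F. nm_segment n m S"
      unfolding admissible_def by blast
    have "(\<Sum>S\<in>F. \<bar>\<Sum>t\<in>S. Rep_N x t + u t\<bar>) \<le> (\<Sum>S\<in>F. \<bar>\<Sum>t\<in>S. Rep_N x t\<bar> + \<bar>\<Sum>t\<in>S. u t\<bar>)"
      by (intro sum_mono) (simp add: sum.distrib abs_triangle_ineq)
    then have tri: "(\<Sum>S\<in>F. \<bar>\<Sum>t\<in>S. Rep_N x t + u t\<bar>)
        \<le> (\<Sum>S\<in>F. \<bar>\<Sum>t\<in>S. Rep_N x t\<bar>) + (\<Sum>S\<in>F. \<bar>\<Sum>t\<in>S. u t\<bar>)"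
      by (simp add: sum.distrib)
    show "(\<Sum>S\<in>F. \<bar>\<Sum>t\<in>S. Rep_N x t + u t\<bar>) \<le> max 1 (norm x) + 1 / real K"
    proof (cases "n \<le> L")
      case True
      have "(\<Sum>S\<in>F. \<bar>\<Sum>t\<in>S. Rep_N x t\<bar>) \<le> norm x"
        using jh_norm_upper[OF finite_support_N F] by (simp add: norm_N.rep_eq)
      with tri fan_sum_le_deep[OF nm supp bound True, of "\<lambda>t. t"] show ?thesis by simp
    next
      case False
      have "Rep_N x t = 0" if "S \<in> F" "t \<in> S" for S t
        using segment_take(1)[of n m S t] nm(3) that False x[of t] by fastforce
      then have "(\<Sum>S\<in>F. \<bar>\<Sum>t\<in>S. Rep_N x t\<bar>) = 0" by simp
      with tri fan_sum_le_any[OF nm supp bound, of "\<lambda>t. t"] show ?thesis by simp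
    qed
  qed
  then show ?thesis by (simp add: norm_N.rep_eq plus_N.rep_eq u_def)
qed

lemma N_supports_bounded:
  assumes "finite A"
  shows "\<exists>L. \<forall>x\<in>A. \<forall>t. Rep_N x t \<noteq> 0 \<longrightarrow> length t \<le> L \<and> (\<forall>i\<in>set t. i < L)"
proof -
  define T where "T = (\<Union>x\<in>A. {t. Rep_N x t \<noteq> 0})"
  have T: "finite T" unfolding T_def using assms finite_support_N by auto
  \<comment> \<open>\<open>Suc\<close> makes the bound on entries strict, so \<open>Max V\<close>
    itself is a fresh entry.\<close>
  define V where "V = length ` T \<union> Suc ` \<Union>(set ` T)"
  have "finite V" using T by (simp add: V_def)
  then have "v \<le> Max V" if "v \<in> V" for v using that by simp
  then have "length t \<le> Max V" "\<forall>i\<in>set t. Suc i \<le> Max V" if "t \<in> T" for t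
    using that unfolding V_def by blast+
  then show ?thesis unfolding T_def by (intro exI[of _ "Max V"]) (auto simp: Suc_le_eq)
qed

section \<open>The space M\<close>

text \<open>Adding the fans in a fresh part of the tree: if a segment family starts at level \<open>n\<close>, then
  one may adjoin the segments through the fan nodes of level \<open>n\<close>, which pick up nothing but the
  total mass 1 of that fan.\<close>

lemma segments_add_fans:
  assumes n: "1 \<le> n" "n \<le> m" "n \<le> L" and K: "K > 0"
    and F: "finite F" "pairwise disjnt F" "\<forall>S\<in>F. nm_segment n m S"
    and z: "\<And>t i. Rep_N z t \<noteq> 0 \<Longrightarrow> i \<in> set t \<Longrightarrow> i < k"
  shows "(\<Sum>S\<in>F. \<bar>\<Sum>t\<in>S. Rep_N z t\<bar>) + \<bar>l\<bar> \<le> norm (l *\<^sub>R (\<Sum>a<L. fan k K a) + z)"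
proof -
  define x where "x = (\<Sum>a<L. 1 *\<^sub>R fan k K a)"
  let ?w = "\<lambda>t. Rep_N (l *\<^sub>R x + z) t"
  have w: "?w t = l * Rep_N x t + Rep_N z t" for t by (simp add: plus_N.rep_eq scaleR_N.rep_eq)
  \<comment> \<open>For \<open>i\<close> in \<open>{k<..k + K}\<close> this is a node of length
    \<open>n\<close> in the fan of level \<open>n - 1\<close>, which is a summand of
    \<open>x\<close> because \<open>n\<close> lies between 1 and \<open>L\<close>. The zeros in
    \<open>G i\<close> only prolong it to length \<open>m\<close>.\<close>
  define s where "s i = replicate (n - 1) k @ [i]" for i
  define G where "G i = {t. prefix (s i) t \<and> prefix t (s i @ replicate (m - n) 0)}" for i
  have segG: "nm_segment n m (G i)" for i
    unfolding nm_segment_def G_def using n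
    by (intro exI[of _ "s i"] exI[of _ "s i @ replicate (m - n) 0"]) (auto simp: s_def)
  have sG: "s i \<in> G i" for i by (simp add: G_def)
  have takeG: "take n t = s i" if "t \<in> G i" for t i
    using that n by (auto simp: G_def s_def prefix_def)
  have disjG: "disjnt (G i) (G j)" if "i \<noteq> j" for i j
  proof -
    have "s i \<noteq> s j" using that by (simp add: s_def)
    then show ?thesis using takeG unfolding disjnt_iff by metis
  qed
  \<comment> \<open>The first entry is \<open>k\<close> for \<open>n > 1\<close> and
    \<open>i\<close> for \<open>n = 1\<close>; both are too large for the support of
    \<open>z\<close>.\<close>
  have hdG: "k \<le> hd t \<and> t \<noteq> []" if "t \<in> G i" "i > k" for t i
    using that by (cases "n - 1") (auto simp: G_def s_def prefix_def)
  have zG: "Rep_N z t = 0" if "t \<in> G i" "i > k" for t i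
    using hdG[OF that] z[of t "hd t"] by force
  have s_fan: "s i \<in> fan_nodes k K (n - 1)" if "i \<in> {k<..k + K}" for i
    using that by (auto simp: s_def fan_nodes_def)
  have sumG: "(\<Sum>t\<in>G i. ?w t) = l / real K" if i: "i \<in> {k<..k + K}" for i
  proof -
    have xs: "Rep_N x (s i) = 1 / real K"
      using Rep_N_fans[of "{..<L}", OF _ s_fan[OF i], of "\<lambda>_. 1"] n unfolding x_def by simp
    have supp: "\<exists>a. t \<in> fan_nodes k K a" if "Rep_N x t \<noteq> 0" for t
    proof (rule ccontr)
      assume "\<nexists>a. t \<in> fan_nodes k K a"
      then have "Rep_N x t = 0" unfolding x_def by (intro Rep_N_fans_0) simp
      with that show False by simp
    qed
    have "sum (Rep_N x) (G i) = Rep_N x (s i)"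
      by (rule segment_fan_sum[OF segG supp sG]) (use xs K in simp_all)
    then have "sum (Rep_N x) (G i) = 1 / real K" using xs by simp
    moreover have "(\<Sum>t\<in>G i. ?w t) = (\<Sum>t\<in>G i. l * Rep_N x t)"
      using zG i by (intro sum.cong) (auto simp: w)
    ultimately show ?thesis by (simp flip: sum_distrib_left)
  qed
  \<comment> \<open>Members on which \<open>z\<close> vanishes contribute nothing but might meet the
    fans, so they are dropped. As \<open>n \<ge> 1\<close>, all nodes of a remaining member share
    their first entry with a node in the support of \<open>z\<close>; it is below \<open>k\<close>,
    which keeps them off the fans and off every \<open>G i\<close> with
    \<open>i > k\<close>.\<close>
  define F' where "F' = {S\<in>F. \<exists>t\<in>S. Rep_N z t \<noteq> 0}"
  have hdF: "hd t < k \<and> t \<noteq> []" if S: "S \<in> F'" "t \<in> S" for S t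
  proof -
    have seg: "nm_segment n m S" using S F(3) by (auto simp: F'_def)
    obtain v where v: "v \<in> S" "Rep_N z v \<noteq> 0" using S by (auto simp: F'_def)
    have ne: "t \<noteq> []" "v \<noteq> []" using segment_take(1)[OF seg] S(2) v(1) n by force+
    then have "hd t = hd v" using segment_chain[OF seg S(2) v(1)] by (auto simp: prefix_def)
    with ne z[OF v(2), of "hd v"] show ?thesis by simp
  qed
  have disj: "disjnt S (G i)" if "S \<in> F'" "i > k" for S i
    unfolding disjnt_iff using hdF[OF that(1)] hdG[OF _ that(2)] leD by metis
  have inj: "inj_on G {k<..k + K}"
    unfolding inj_on_def using disjG sG disjnt_iff by metis
  define H where "H = F' \<union> G ` {k<..k + K}"
  have admH: "admissible H"
    unfolding admissible_def
  proof (intro conjI)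
    show "finite H" using F(1) by (simp add: H_def F'_def)
    show "pairwise disjnt H"
      unfolding pairwise_def
    proof (intro ballI impI)
      fix S T assume ST: "S \<in> H" "T \<in> H" "S \<noteq> T"
      have "S \<in> F' \<or> (\<exists>i>k. S = G i)" "T \<in> F' \<or> (\<exists>i>k. T = G i)"
        using ST(1,2) by (auto simp: H_def)
      then consider "S \<in> F'" "T \<in> F'" | i where "S \<in> F'" "T = G i" "i > k"
        | i where "T \<in> F'" "S = G i" "i > k" | i j where "S = G i" "T = G j"
        by blast
      then show "disjnt S T"
      proof cases
        case 1
        then show ?thesis using F(2) ST(3) by (auto simp: F'_def pairwise_def)
      next
        case 2
        then show ?thesis using disj by simp
      next
        case 3
        then show ?thesis using disj disjnt_sym by blast
      next
        case 4
        then show ?thesis using disjG ST(3) by metis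
      qed
    qed
    have "\<forall>S\<in>H. nm_segment n m S" using F(3) segG by (auto simp: H_def F'_def)
    with n(2) show "\<exists>n m. n \<le> m \<and> (\<forall>S\<in>H. nm_segment n m S)" by blast
  qed
  have "(\<Sum>S\<in>F. \<bar>\<Sum>t\<in>S. Rep_N z t\<bar>) = (\<Sum>S\<in>F'. \<bar>\<Sum>t\<in>S. Rep_N z t\<bar>)"
    using F(1) by (intro sum.mono_neutral_right) (auto simp: F'_def)
  also have "\<dots> = (\<Sum>S\<in>F'. \<bar>\<Sum>t\<in>S. ?w t\<bar>)"
  proof -
    have "Rep_N x t = 0" if "S \<in> F'" "t \<in> S" for S t
      unfolding x_def
    proof (rule Rep_N_fans_0)
      fix a
      have "k \<le> hd t" if "t \<in> fan_nodes k K a"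
        using that by (cases a) (auto simp: fan_nodes_def)
      then show "t \<notin> fan_nodes k K a" using hdF[OF that] leD by blast
    qed
    then show ?thesis by (simp add: w)
  qed
  finally have "(\<Sum>S\<in>F. \<bar>\<Sum>t\<in>S. Rep_N z t\<bar>) = (\<Sum>S\<in>F'. \<bar>\<Sum>t\<in>S. ?w t\<bar>)" .
  moreover have "(\<Sum>S\<in>G ` {k<..k + K}. \<bar>\<Sum>t\<in>S. ?w t\<bar>) = (\<Sum>i\<in>{k<..k + K}. \<bar>l / real K\<bar>)"
    unfolding sum.reindex[OF inj] comp_def using sumG by (intro sum.cong refl) (simp only:)
  moreover have "(\<Sum>i\<in>{k<..k + K}. \<bar>l / real K\<bar>) = \<bar>l\<bar>" using K by simp
  moreover have "F' \<inter> G ` {k<..k + K} = {}"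
    using disj sG unfolding disjnt_iff by fastforce
  ultimately have "(\<Sum>S\<in>F. \<bar>\<Sum>t\<in>S. Rep_N z t\<bar>) + \<bar>l\<bar> = (\<Sum>S\<in>H. \<bar>\<Sum>t\<in>S. ?w t\<bar>)"
    using F(1) unfolding H_def by (subst sum.union_disjoint) (auto simp: F'_def)
  also have "\<dots> \<le> norm (l *\<^sub>R x + z)"
    using jh_norm_upper[OF finite_support_N admH] by (simp add: norm_N.rep_eq)
  finally show ?thesis by (simp add: x_def)
qed

text \<open>\<open>segments_add_fans\<close> settles the families starting at levels 1 to
  \<open>L\<close>. Deeper families do not see \<open>z\<close>, and those starting at the root are
  moved to level 1.\<close>

lemma norm_fans_add_ge:
  assumes L: "L > 0" and K: "K > 0"
    and z: "\<And>t. Rep_N z t \<noteq> 0 \<Longrightarrow> length t \<le> L \<and> (\<forall>i\<in>set t. i < k)"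
  shows "norm z + \<bar>l\<bar> \<le> norm (l *\<^sub>R (\<Sum>a<L. fan k K a) + z)"
proof -
  let ?w = "l *\<^sub>R (\<Sum>a<L. fan k K a) + z"
  have z': "\<And>t i. Rep_N z t \<noteq> 0 \<Longrightarrow> i \<in> set t \<Longrightarrow> i < k" using z by blast
  \<comment> \<open>The empty family at level 1: the fan of level 0, present since
    \<open>L > 0\<close>, already yields the modulus of \<open>l\<close>.\<close>
  have trivial: "\<bar>l\<bar> \<le> norm ?w"
    using segments_add_fans[of 1 1 L K "{}" z k l] L K z' by simp
  have "jh_norm (Rep_N z) \<le> norm ?w - \<bar>l\<bar>"
  proof (rule jh_norm_least)
    fix F assume "admissible F"
    then obtain n m where nm: "n \<le> m" and F: "finite F" "pairwise disjnt F" "\<forall>S\<in>F. nm_segment n m S"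
      unfolding admissible_def by blast
    have "(\<Sum>S\<in>F. \<bar>\<Sum>t\<in>S. Rep_N z t\<bar>) + \<bar>l\<bar> \<le> norm ?w"
    proof (cases "n = 0")
      case False
      show ?thesis
      proof (cases "n \<le> L")
        case True
        then show ?thesis using segments_add_fans[OF _ nm True K F z'] False by simp
      next
        case deep: False
        have "Rep_N z t = 0" if "S \<in> F" "t \<in> S" for S t
          using segment_take(1)[of n m S t] F(3) that deep z[of t] by fastforce
        then show ?thesis using trivial by simp
      qed
    next
      case True
      \<comment> \<open>All these segments contain the root, so there is at most one, and the root can be removed
        from it since \<open>z\<close> vanishes there.\<close>
      have root: "[] \<in> S" if "S \<in> F" for S using F(3) that True by (auto simp: nm_segment_def)
      show ?thesis
      proof (cases "F = {}")
        case False
        then obtain S where S: "S \<in> F" by blast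
        have "T = S" if "T \<in> F" for T
          using F(2) root[OF that] root[OF S] that S unfolding pairwise_def disjnt_iff by blast
        then have FS: "F = {S}" using S by blast
        have sum: "(\<Sum>t\<in>S. Rep_N z t) = (\<Sum>t\<in>S - {[]}. Rep_N z t)"
          using F(3) S finite_segment by (intro sum.mono_neutral_right) (auto simp: Rep_N_Nil)
        from F(3) S True obtain s' where s': "length s' = m" "S = {t. prefix t s'}"
          by (auto simp: nm_segment_def)
        show ?thesis
        proof (cases s')
          case Nil
          then have "S - {[]} = {}" using s' by auto
          then have "(\<Sum>t\<in>S. Rep_N z t) = 0" unfolding sum by (simp only: sum.empty)
          then show ?thesis using trivial FS by simp
        next
          case (Cons i r)
          have "nm_segment 1 m (S - {[]})"
            unfolding nm_segment_def using s' Cons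
            by (intro exI[of _ "[i]"] exI[of _ s']) (auto simp: prefix_Cons)
          moreover have "1 \<le> m" using s' Cons by simp
          ultimately show ?thesis
            using segments_add_fans[of 1 m L K "{S - {[]}}" z k l] L K z' sum FS by simp
        qed
      qed (use trivial in simp)
    qed
    then show "(\<Sum>S\<in>F. \<bar>\<Sum>t\<in>S. Rep_N z t\<bar>) \<le> norm ?w - \<bar>l\<bar>" by simp
  qed
  then show ?thesis by (simp add: norm_N.rep_eq)
qed

lemma octahedral_M: "octahedral_norm TYPE(M)"
proof (rule octahedral_normI)
  fix A :: "M set" and e :: real
  assume A: "finite A" and e: "e > 0"
  \<comment> \<open>Each \<open>z\<close> is exchanged for a finitely supported vector; the two
    changes of \<open>e / 2\<close> make up the additive error \<open>e\<close>.\<close>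
  obtain p :: "M \<Rightarrow> N" where p: "dist z (to_completion (p z)) < e / 2" for z
    using to_completion_approx[of "e / 2"] e by (metis half_gt_zero)
  from N_supports_bounded[of "p ` A"] A obtain L' where
    "\<forall>x\<in>p ` A. \<forall>t. Rep_N x t \<noteq> 0 \<longrightarrow> length t \<le> L' \<and> (\<forall>i\<in>set t. i < L')" by blast
  then have L': "\<And>z t. z \<in> A \<Longrightarrow> Rep_N (p z) t \<noteq> 0 \<Longrightarrow> length t \<le> Suc L' \<and> (\<forall>i\<in>set t. i < L')"
    by force
  obtain K' where "inverse (real (Suc K')) < e" using reals_Archimedean[OF e] by blast
  then obtain K where K: "K > 0" "1 / real K < e" by (metis inverse_eq_divide zero_less_Suc)
  \<comment> \<open>\<open>L'\<close> exceeds all entries in the supports, so it is fresh; the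
    \<open>Suc L'\<close> levels cover all lengths that occur and are at least one in
    number.\<close>
  define x where "x = (\<Sum>a<Suc L'. fan L' K a)"
  have "norm (0 + (\<Sum>a<Suc L'. 1 *\<^sub>R fan L' K a)) \<le> max 1 (norm (0 :: N)) + 1 / real K"
    by (rule norm_add_fans_le[OF K(1), of _ 0]) (auto simp: zero_N.rep_eq)
  then have nx: "norm x \<le> 1 + 1 / real K" by (simp add: x_def del: sum.lessThan_Suc)
  \<comment> \<open>This factor brings \<open>x\<close> into the unit ball, and
    \<open>1 - e \<le> c\<close> keeps the loss within the allowed factor.\<close>
  define c where "c = 1 / (1 + 1 / real K)"
  have "1 - 1 / real K \<le> c" using K by (simp add: c_def field_simps)
  then have c: "c > 0" "1 - e \<le> c" using K by (auto simp: c_def intro!: divide_pos_pos add_pos_pos)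
  have pos: "1 + 1 / real K > 0" using K(1) by (simp add: add_pos_pos)
  have "c * norm x \<le> c * (1 + 1 / real K)" using nx c(1) by (intro mult_left_mono) auto
  also have "\<dots> = 1" using pos by (simp add: c_def)
  finally have "norm (to_completion (c *\<^sub>R x)) \<le> 1" using c by simp
  moreover have "(1 - e) * \<bar>l\<bar> + norm z - e \<le> norm (l *\<^sub>R to_completion (c *\<^sub>R x) + z)"
    if z: "z \<in> A" for z :: M and l :: real
  proof -
    let ?y = "l *\<^sub>R to_completion (c *\<^sub>R x)"
    have "norm (p z) + \<bar>l * c\<bar> \<le> norm ((l * c) *\<^sub>R x + p z)"
      unfolding x_def by (rule norm_fans_add_ge[OF _ K(1) L'[OF z]]) simp
    also have "\<dots> = norm (to_completion ((l * c) *\<^sub>R x + p z))" by simp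
    also have "to_completion ((l * c) *\<^sub>R x + p z) = ?y + to_completion (p z)"
      by (simp add: linear_add[OF linear_to_completion] linear_scale[OF linear_to_completion])
    also have "norm \<dots> \<le> norm (?y + z) + dist z (to_completion (p z))"
      using norm_triangle_ineq[of "?y + z" "to_completion (p z) - z"]
      by (simp add: dist_norm norm_minus_commute)
    finally have "norm (p z) + \<bar>l * c\<bar> \<le> norm (?y + z) + e / 2" using p[of z] by simp
    moreover have "norm z \<le> norm (p z) + e / 2"
      using norm_triangle_ineq2[of z "to_completion (p z)"] p[of z] by (simp add: dist_norm)
    moreover have "(1 - e) * \<bar>l\<bar> \<le> \<bar>l * c\<bar>"
      using c mult_right_mono[OF c(2), of "\<bar>l\<bar>"] by (simp add: abs_mult mult.commute)
    ultimately show ?thesis by linarith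
  qed
  ultimately show "\<exists>x::M. norm x \<le> 1 \<and>
      (\<forall>z\<in>A. \<forall>l. (1 - e) * \<bar>l\<bar> + norm z - e \<le> norm (l *\<^sub>R x + z))" by blast
qed

section \<open>Fans against functionals and slices of the ball of \<open>M\<close>\<close>

text \<open>Signed sums of fans are uniformly bounded, so the values of a functional on them are
  absolutely summable.\<close>

lemma fans_weakly_null:
  fixes f :: "M \<Rightarrow>\<^sub>L real"
  assumes K: "K > 0"
  shows "(\<lambda>a. blinfun_apply f (to_completion (fan k K a))) \<longlonglongrightarrow> 0"
proof -
  let ?v = "\<lambda>a. blinfun_apply f (to_completion (fan k K a))"
  have "summable (\<lambda>a. \<bar>?v a\<bar>)"
  proof (rule summableI_nonneg_bounded)
    fix J
    \<comment> \<open>The signs turn the partial sum of moduli into one value of \<open>f\<close>,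
      at a vector of norm at most \<open>1 + 1 / real K\<close>.\<close>
    let ?u = "\<Sum>a<J. sgn (?v a) *\<^sub>R fan k K a"
    have "norm (0 + ?u) \<le> max 1 (norm (0 :: N)) + 1 / real K"
      by (rule norm_add_fans_le[OF K, of _ 0]) (auto simp: zero_N.rep_eq abs_sgn_eq)
    then have u: "norm ?u \<le> 1 + 1 / real K" by simp
    have "(\<Sum>a<J. \<bar>?v a\<bar>) = f (to_completion ?u)"
      by (simp add: linear_sum[OF linear_to_completion] linear_scale[OF linear_to_completion]
          blinfun.sum_right blinfun.scaleR_right abs_sgn mult.commute)
    also have "\<dots> \<le> norm f * norm ?u" using norm_blinfun[of f "to_completion ?u"] by simp
    also have "\<dots> \<le> norm f * (1 + 1 / real K)" by (intro mult_left_mono u) simp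
    finally show "(\<Sum>a<J. \<bar>?v a\<bar>) \<le> norm f * (1 + 1 / real K)" .
  qed simp
  then show ?thesis using summable_LIMSEQ_zero tendsto_rabs_zero_iff by blast
qed

text \<open>Shrinking a point of the slice slightly moves it into the open ball and, by continuity
  of \<open>f\<close>, keeps it in the slice. Around it an open set stays in the slice, and density
  provides an element of the range there.\<close>

lemma slice_meets_range_to_completion:
  fixes f :: "'a::real_normed_vector completion \<Rightarrow>\<^sub>L real"
  assumes "\<alpha> > 0"
  shows "\<exists>x. to_completion x \<in> slice (cball 0 1) f \<alpha>"
proof -
  let ?t = "(SUP y\<in>cball 0 1. blinfun_apply f y) - \<alpha>"
  have "\<exists>z\<in>cball 0 1. ?t < f z"
  proof (rule ccontr)
    assume "\<not> ?thesis"
    then have "(SUP y\<in>cball 0 1. blinfun_apply f y) \<le> ?t" by (intro cSUP_least) force+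
    with assms show False by simp
  qed
  then obtain z where z: "norm z \<le> 1" "?t < f z" by auto
  have "((\<lambda>r. f (r *\<^sub>R z)) \<longlongrightarrow> f (1 *\<^sub>R z)) (at_left 1)" by (intro tendsto_intros)
  then have "\<forall>\<^sub>F r in at_left 1. ?t < f (r *\<^sub>R z)" using z(2) by (intro order_tendstoD(1)) auto
  moreover have "\<forall>\<^sub>F r in at_left (1::real). r \<in> {0<..<1}" by (rule eventually_at_left_real) simp
  ultimately have "\<forall>\<^sub>F r in at_left 1. ?t < f (r *\<^sub>R z) \<and> r \<in> {0<..<1}" by (rule eventually_conj)
  then obtain r where r: "?t < f (r *\<^sub>R z)" "0 < r" "r < 1"
    using eventually_happens[of _ "at_left (1::real)"] by force
  define U where "U = {y. ?t < f y} \<inter> ball 0 1"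
  have "open U" unfolding U_def by (intro open_Int open_ball open_Collect_less continuous_intros)
  have "r * norm z < 1"
    by (rule order.strict_trans1[OF mult_left_le[OF z(1)] r(3)]) (use r(2) in simp)
  then have "r *\<^sub>R z \<in> U" using r by (simp add: U_def)
  with \<open>open U\<close> obtain d where d: "d > 0" "ball (r *\<^sub>R z) d \<subseteq> U" by (rule openE)
  from to_completion_approx[OF d(1), of "r *\<^sub>R z"] obtain x
    where "dist (r *\<^sub>R z) (to_completion x) < d" by (rule exE)
  then have "to_completion x \<in> U" using d(2) by (simp add: subset_iff)
  then show ?thesis by (intro exI[of _ x]) (simp add: U_def slice_def)
qed

text \<open>The singletons of the fan nodes form an admissible family, as these nodes all have
  length \<open>Suc a\<close>. This bounds the sum by the norm on \<open>N\<close>, and the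
  functional extends to \<open>M\<close>.\<close>

lemma fan_functional:
  "\<exists>g :: M \<Rightarrow>\<^sub>L real. norm g \<le> 1 \<and>
    (\<forall>x. blinfun_apply g (to_completion x) = (\<Sum>t\<in>fan_nodes k K a. Rep_N x t))"
proof -
  let ?g = "\<lambda>x. \<Sum>t\<in>fan_nodes k K a. Rep_N x t"
  have le: "\<bar>?g x\<bar> \<le> norm x" for x
  proof -
    have "nm_segment (Suc a) (Suc a) {t}" if "t \<in> fan_nodes k K a" for t
      unfolding nm_segment_def using length_fan_nodes[OF that]
      by (intro exI[of _ t]) (auto dest: prefix_order.antisym)
    then have adm: "admissible ((\<lambda>t. {t}) ` fan_nodes k K a)"
      unfolding admissible_def by (auto simp: finite_fan_nodes pairwise_def)
    have "\<bar>?g x\<bar> \<le> (\<Sum>t\<in>fan_nodes k K a. \<bar>Rep_N x t\<bar>)" by (rule sum_abs)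
    also have "\<dots> = (\<Sum>S\<in>(\<lambda>t. {t}) ` fan_nodes k K a. \<bar>\<Sum>t\<in>S. Rep_N x t\<bar>)"
      by (subst sum.reindex) (auto simp: inj_on_def)
    also have "\<dots> \<le> norm x" using jh_norm_upper[OF finite_support_N adm] by (simp add: norm_N.rep_eq)
    finally show ?thesis .
  qed
  have bl: "bounded_linear ?g"
    by (rule bounded_linear_intro[of _ 1])
      (use le in \<open>auto simp: plus_N.rep_eq scaleR_N.rep_eq sum.distrib sum_distrib_left\<close>)
  have "norm (Blinfun ?g) \<le> 1"
    by (rule norm_blinfun_bound) (use le in \<open>auto simp: bounded_linear_Blinfun_apply[OF bl]\<close>)
  then show ?thesis
    using blinfun_extend_completion[of "Blinfun ?g"]
    by (auto simp: bounded_linear_Blinfun_apply[OF bl] intro: order_trans)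
qed

text \<open>Each slice contains a finitely supported \<open>x S\<close> and, after rescaling by
  \<open>c\<close>, also \<open>x S\<close> plus or minus a common deep fan. The functional of that
  fan vanishes at every \<open>x S\<close>, so it takes the values \<open>c\<close> and
  \<open>- c\<close> at these points.\<close>

lemma slices_separated_M:
  fixes \<S> :: "M set set"
  assumes fin: "finite \<S>" and S: "\<forall>S\<in>\<S>. is_slice_of S (cball 0 1)" and e: "e > 0"
  shows "\<exists>g::M \<Rightarrow>\<^sub>L real. norm g \<le> 1 \<and>
    (\<forall>S\<in>\<S>. (\<exists>a\<in>S. 1 - e \<le> blinfun_apply g a) \<and> (\<exists>b\<in>S. blinfun_apply g b \<le> e - 1))"
proof -
  from S have "\<forall>S\<in>\<S>. \<exists>f \<alpha> x. S = slice (cball 0 1) f \<alpha> \<and> to_completion x \<in> S"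
    unfolding is_slice_of_def using slice_meets_range_to_completion by metis
  then obtain f \<alpha> x where f: "\<And>S. S \<in> \<S> \<Longrightarrow> S = slice (cball 0 1) (f S) (\<alpha> S)"
    and x: "\<And>S. S \<in> \<S> \<Longrightarrow> to_completion (x S) \<in> S" by metis
  define \<tau> where "\<tau> S = (SUP y\<in>cball 0 1. blinfun_apply (f S) y) - \<alpha> S" for S
  have mem: "y \<in> S \<longleftrightarrow> norm y \<le> 1 \<and> \<tau> S < f S y" if "S \<in> \<S>" for S y
    using f[OF that] by (auto simp: slice_def \<tau>_def)
  have x1: "norm (x S) \<le> 1" "\<tau> S < f S (to_completion (x S))" if "S \<in> \<S>" for S
    using x[OF that] mem[OF that] by auto
  \<comment> \<open>Half of the gap is reserved for the rescaling by \<open>c\<close>, half for the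
    fan.\<close>
  define \<eta> where "\<eta> S = (f S (to_completion (x S)) - \<tau> S) / 2" for S
  have \<eta>: "\<eta> S > 0" if "S \<in> \<S>" for S using x1(2)[OF that] by (simp add: \<eta>_def)
  \<comment> \<open>\<open>K\<close> is fixed before the level \<open>a\<close>, as the weak nullity
    of the fans refers to a given \<open>K\<close>.\<close>
  have "\<forall>\<^sub>F K in sequentially. norm (f S) / real K < \<eta> S" if "S \<in> \<S>" for S
    using \<eta>[OF that] by (intro order_tendstoD(2)[OF lim_const_over_n])
  then have "\<forall>\<^sub>F K in sequentially. \<forall>S\<in>\<S>. norm (f S) / real K < \<eta> S"
    by (intro eventually_ball_finite fin) auto
  moreover have "\<forall>\<^sub>F K in sequentially. 1 / real K < e"
    using e by (intro order_tendstoD(2)[OF lim_const_over_n])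
  ultimately have "\<forall>\<^sub>F K in sequentially. (\<forall>S\<in>\<S>. norm (f S) / real K < \<eta> S) \<and> 1 / real K < e \<and> K > 0"
    using eventually_gt_at_top[of 0] by eventually_elim auto
  then obtain K where K: "K > 0" "1 / real K < e"
    and fK: "\<And>S. S \<in> \<S> \<Longrightarrow> norm (f S) / real K < \<eta> S"
    using eventually_happens'[OF sequentially_bot] by blast
  from N_supports_bounded[of "x ` \<S>"] fin obtain L where
    L: "\<And>S t. S \<in> \<S> \<Longrightarrow> Rep_N (x S) t \<noteq> 0 \<Longrightarrow> length t \<le> L" by blast
  \<comment> \<open>The entry 0 may occur in the supports: here the fan is kept apart from them by
    its level, since \<open>L \<le> a\<close>.\<close>
  let ?v = "\<lambda>a. fan 0 K a"
  have "\<forall>\<^sub>F a in sequentially. \<bar>f S (to_completion (?v a))\<bar> < \<eta> S" if "S \<in> \<S>" for S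
    using \<eta>[OF that] tendsto_rabs_zero[OF fans_weakly_null[OF K(1)]] by (intro order_tendstoD(2))
  then have "\<forall>\<^sub>F a in sequentially. \<forall>S\<in>\<S>. \<bar>f S (to_completion (?v a))\<bar> < \<eta> S"
    by (intro eventually_ball_finite fin) auto
  then have "\<forall>\<^sub>F a in sequentially. (\<forall>S\<in>\<S>. \<bar>f S (to_completion (?v a))\<bar> < \<eta> S) \<and> L \<le> a"
    using eventually_ge_at_top[of L] by eventually_elim auto
  then obtain a where a: "L \<le> a" and fa: "\<And>S. S \<in> \<S> \<Longrightarrow> \<bar>f S (to_completion (?v a))\<bar> < \<eta> S"
    using eventually_happens'[OF sequentially_bot] by blast
  from fan_functional[of 0 K a] obtain g :: "M \<Rightarrow>\<^sub>L real" where g: "norm g \<le> 1"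
    "\<And>x. g (to_completion x) = (\<Sum>t\<in>fan_nodes 0 K a. Rep_N x t)" by blast
  have gx: "g (to_completion (x S)) = 0" if "S \<in> \<S>" for S
    unfolding g(2) using L[OF that] length_fan_nodes[of _ 0 K a] a
    by (intro sum.neutral) (metis not_less_eq_eq)
  have gv: "g (to_completion (?v a)) = 1"
    unfolding g(2) using K(1) by (simp add: fan.rep_eq card_fan_nodes)
  define c where "c = 1 / (1 + 1 / real K)"
  have pos: "1 + 1 / real K > 0" using K(1) by (simp add: add_pos_pos)
  have c: "0 < c" "c \<le> 1" "1 - 1 / real K \<le> c"
    using K(1) by (auto simp: c_def field_simps add_pos_pos)
  define y where "y S \<theta> = c *\<^sub>R (to_completion (x S) + \<theta> *\<^sub>R to_completion (?v a))" for S and \<theta> :: real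
  have yS: "y S \<theta> \<in> S" if S: "S \<in> \<S>" and \<theta>: "\<bar>\<theta>\<bar> = 1" for S \<theta>
  proof -
    have "norm (x S + (\<Sum>b\<in>{a}. \<theta> *\<^sub>R ?v b)) \<le> max 1 (norm (x S)) + 1 / real K"
      by (rule norm_add_fans_le[OF K(1), of _ L]) (use a \<theta> L[OF S] in auto)
    then have "c * norm (x S + \<theta> *\<^sub>R ?v a) \<le> c * (1 + 1 / real K)"
      using x1(1)[OF S] c(1) by (intro mult_left_mono) auto
    also have "\<dots> = 1" using pos by (simp add: c_def)
    finally have "c * norm (x S + \<theta> *\<^sub>R ?v a) \<le> 1" .
    moreover have "y S \<theta> = to_completion (c *\<^sub>R (x S + \<theta> *\<^sub>R ?v a))"
      by (simp add: y_def linear_add[OF linear_to_completion] linear_scale[OF linear_to_completion])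
    ultimately have "norm (y S \<theta>) \<le> 1" using c(1) by simp
    moreover have "\<tau> S < f S (y S \<theta>)"
    proof -
      let ?X = "f S (to_completion (x S))" and ?V = "f S (to_completion (?v a))"
      have "\<bar>?X\<bar> \<le> norm (f S)"
        using norm_blinfun[of "f S" "to_completion (x S)"] x1(1)[OF S]
          mult_left_le[of "norm (x S)" "norm (f S)"] by simp
      then have "(1 - c) * \<bar>?X\<bar> \<le> 1 / real K * norm (f S)"
        using c by (intro mult_mono) auto
      moreover have "(1 - c) * ?X \<le> (1 - c) * \<bar>?X\<bar>" using c by (intro mult_left_mono) auto
      ultimately have "(1 - c) * ?X \<le> 1 / real K * norm (f S)" by linarith
      then have "?X - c * ?X < \<eta> S" using fK[OF S] by (simp add: algebra_simps)
      moreover have "\<bar>c * (\<theta> * ?V)\<bar> \<le> \<bar>?V\<bar>"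
        using c \<theta> by (simp add: abs_mult mult_left_le_one_le)
      moreover have "f S (y S \<theta>) = c * ?X + c * (\<theta> * ?V)"
        by (simp add: y_def blinfun.add_right blinfun.scaleR_right distrib_left)
      ultimately show ?thesis using fa[OF S] by (simp add: \<eta>_def abs_le_iff abs_less_iff)
    qed
    ultimately show ?thesis using mem[OF S] by blast
  qed
  have gy: "g (y S \<theta>) = c * \<theta>" if "S \<in> \<S>" for S \<theta>
    by (simp add: y_def blinfun.add_right blinfun.scaleR_right gx[OF that] gv)
  have "(\<exists>a\<in>S. 1 - e \<le> g a) \<and> (\<exists>b\<in>S. g b \<le> e - 1)" if "S \<in> \<S>" for S
    using yS[OF that, of 1] yS[OF that, of "-1"] gy[OF that, of 1] gy[OF that, of "-1"] c(3) K(2)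
    by (intro conjI bexI[of _ "y S 1"] bexI[of _ "y S (-1)"]) auto
  with g(1) show ?thesis by blast
qed

theorem mainTheorem9:
  "octahedral_norm TYPE(M) \<and> strong_diameter_two TYPE(M) \<and> octahedral_norm TYPE(M \<Rightarrow>\<^sub>L real)"
  using octahedral_M strong_diameter_twoI[OF slices_separated_M]
    octahedral_norm_dualI[OF slices_separated_M] by blast

end
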